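(* For every $n \ge 2$, the pure virtual twin group $PVT_n$ has the presentation $$\big\langle \lambda_{i,j},\ 1 \le i < j \le n \ \big|\ \lambda_{i,j}\lambda_{k,l} = \lambda_{k,l}\lambda_{i,j} \text{ for pairwise distinct integers } i,j,k,l \text{ with } i<j,\ k<l \big\rangle,$$ where the symbols $\lambda_{i,j}$ correspond to the elements $\lambda_{i,j} \in PVT_n$ defined in the context.
   Context: For $n\ge 2$, the virtual twin group $VT_n$ is the group with generators $s_1,\dots,s_{n-1},\rho_1,\dots,\rho_{n-1}$ and defining relations: $s_i^2=1$ and $\rho_i^2=1$ for $1\le i\le n-1$; $s_is_j=s_js_i$, $\rho_i\rho_j=\rho_j\rho_i$ and $\rho_is_j=s_j\rho_i$ for $|i-j|\ge 2$; $\rho_i\rho_{i+1}\rho_i=\rho_{i+1}\rho_i\rho_{i+1}$ and $\rho_i\rho_{i+1}s_i=s_{i+1}\rho_i\rho_{i+1}$ for $1\le i\le n-2$. The pure virtual twin group $PVT_n$ is the kernel of the surjection $\pi:VT_n\to S_n$, $\pi(s_i)=\pi(\rho_i)=(i,i+1)$. Put $\lambda_{i,i+1}=s_i\rho_i$ for $1\le i\le n-1$, and for $1\le i<j\le n$ with $j\ne i+1$ put $\lambda_{i,j}=\rho_{j-1}\rho_{j-2}\cdots\rho_{i+1}\,\lambda_{i,i+1}\,\rho_{i+1}\cdots\rho_{j-2}\rho_{j-1}$. These are elements of $PVT_n$. *)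

theory Defs
  imports "HOL-Algebra.Sym_Groups" "HOL-Combinatorics.Transposition"
begin

section \<open>Groups given by generators and defining relations\<close>

datatype 'a letter = Gen 'a | Inv 'a

definition words :: "'a set \<Rightarrow> 'a letter list set" where
  "words X = lists (Gen ` X \<union> Inv ` X)"

text \<open>A relation \<open>l = r\<close> is the pair \<open>(l, r)\<close>. Two words over \<open>X\<close> are identified iff this
  follows from the relations in \<open>R\<close> and the group laws.\<close>

inductive_set word_cong :: "'a set \<Rightarrow> ('a letter list \<times> 'a letter list) set
    \<Rightarrow> ('a letter list \<times> 'a letter list) set"
  for X R where
  refl: "w \<in> words X \<Longrightarrow> (w, w) \<in> word_cong X R"
| sym: "(u, v) \<in> word_cong X R \<Longrightarrow> (v, u) \<in> word_cong X R"
| trans: "(u, v) \<in> word_cong X R \<Longrightarrow> (v, w) \<in> word_cong X R \<Longrightarrow> (u, w) \<in> word_cong X R"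
| append: "(u, v) \<in> word_cong X R \<Longrightarrow> (u', v') \<in> word_cong X R
    \<Longrightarrow> (u @ u', v @ v') \<in> word_cong X R"
| Gen_Inv: "x \<in> X \<Longrightarrow> ([Gen x, Inv x], []) \<in> word_cong X R"
| Inv_Gen: "x \<in> X \<Longrightarrow> ([Inv x, Gen x], []) \<in> word_cong X R"
| rel: "(l, r) \<in> R \<Longrightarrow> l \<in> words X \<Longrightarrow> r \<in> words X \<Longrightarrow> (l, r) \<in> word_cong X R"

definition word_class :: "'a set \<Rightarrow> ('a letter list \<times> 'a letter list) set
    \<Rightarrow> 'a letter list \<Rightarrow> 'a letter list set" where
  "word_class X R w = word_cong X R `` {w}"

definition presented_group :: "'a set \<Rightarrow> ('a letter list \<times> 'a letter list) set
    \<Rightarrow> 'a letter list set monoid" where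
  "presented_group X R =
     \<lparr> carrier = words X // word_cong X R,
       mult = (\<lambda>A B. \<Union>a\<in>A. \<Union>b\<in>B. word_class X R (a @ b)),
       one = word_class X R [] \<rparr>"

definition has_presentation :: "('g, 'm) monoid_scheme \<Rightarrow> 'a set
    \<Rightarrow> ('a letter list \<times> 'a letter list) set \<Rightarrow> ('a \<Rightarrow> 'g) \<Rightarrow> bool" where
  "has_presentation G X R \<phi> \<longleftrightarrow>
     group G \<and> \<phi> \<in> X \<rightarrow> carrier G \<and>
     (\<exists>h \<in> iso (presented_group X R) G. \<forall>x\<in>X. h (word_class X R [Gen x]) = \<phi> x)"

primrec letter_eval :: "('g, 'm) monoid_scheme \<Rightarrow> ('a \<Rightarrow> 'g) \<Rightarrow> 'a letter \<Rightarrow> 'g" where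
  "letter_eval G f (Gen x) = f x"
| "letter_eval G f (Inv x) = inv\<^bsub>G\<^esub> (f x)"

definition word_eval :: "('g, 'm) monoid_scheme \<Rightarrow> ('a \<Rightarrow> 'g) \<Rightarrow> 'a letter list \<Rightarrow> 'g" where
  "word_eval G f w = foldr (\<otimes>\<^bsub>G\<^esub>) (map (letter_eval G f) w) \<one>\<^bsub>G\<^esub>"

text \<open>The map on a presented group induced by a map \<open>f\<close> on the generators. It is only meaningful
  if \<open>f\<close> respects the defining relations; see \<open>presented_lift_hom\<close>.\<close>

definition presented_lift :: "('g, 'm) monoid_scheme \<Rightarrow> ('a \<Rightarrow> 'g) \<Rightarrow> 'a letter list set \<Rightarrow> 'g" where
  "presented_lift G f C = the_elem (word_eval G f ` C)"


section \<open>Virtual twin groups\<close>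

datatype vt_gen = Tw nat | Vr nat  \<comment> \<open>the generators \<open>s\<^sub>i\<close> and \<open>\<rho>\<^sub>i\<close>\<close>

abbreviation s_word :: "nat \<Rightarrow> vt_gen letter list" where
  "s_word i \<equiv> [Gen (Tw i)]"

abbreviation \<rho>_word :: "nat \<Rightarrow> vt_gen letter list" where
  "\<rho>_word i \<equiv> [Gen (Vr i)]"

definition vt_gens :: "nat \<Rightarrow> vt_gen set" where
  "vt_gens n = Tw ` {1..n - 1} \<union> Vr ` {1..n - 1}"

definition vt_rels :: "nat \<Rightarrow> (vt_gen letter list \<times> vt_gen letter list) set" where
  "vt_rels n =
     {(s_word i @ s_word i, []) | i. i \<in> {1..n - 1}} \<union>
     {(\<rho>_word i @ \<rho>_word i, []) | i. i \<in> {1..n - 1}} \<union>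
     {(s_word i @ s_word j, s_word j @ s_word i) | i j.
        i \<in> {1..n - 1} \<and> j \<in> {1..n - 1} \<and> \<bar>int i - int j\<bar> \<ge> 2} \<union>
     {(\<rho>_word i @ \<rho>_word j, \<rho>_word j @ \<rho>_word i) | i j.
        i \<in> {1..n - 1} \<and> j \<in> {1..n - 1} \<and> \<bar>int i - int j\<bar> \<ge> 2} \<union>
     {(\<rho>_word i @ s_word j, s_word j @ \<rho>_word i) | i j.
        i \<in> {1..n - 1} \<and> j \<in> {1..n - 1} \<and> \<bar>int i - int j\<bar> \<ge> 2} \<union>
     {(\<rho>_word i @ \<rho>_word (i + 1) @ \<rho>_word i, \<rho>_word (i + 1) @ \<rho>_word i @ \<rho>_word (i + 1)) | i.
        i \<in> {1..n - 2}} \<union>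
     {(\<rho>_word i @ \<rho>_word (i + 1) @ s_word i, s_word (i + 1) @ \<rho>_word i @ \<rho>_word (i + 1)) | i.
        i \<in> {1..n - 2}}"

definition VT :: "nat \<Rightarrow> vt_gen letter list set monoid" where
  "VT n = presented_group (vt_gens n) (vt_rels n)"

primrec vt_transp :: "vt_gen \<Rightarrow> nat \<Rightarrow> nat" where
  "vt_transp (Tw i) = transpose i (i + 1)"
| "vt_transp (Vr i) = transpose i (i + 1)"

definition vt_perm :: "nat \<Rightarrow> vt_gen letter list set \<Rightarrow> nat \<Rightarrow> nat" where
  "vt_perm n = presented_lift (sym_group n) vt_transp"

definition PVT :: "nat \<Rightarrow> vt_gen letter list set monoid" where
  "PVT n = (VT n) \<lparr> carrier := kernel (VT n) (sym_group n) (vt_perm n) \<rparr>"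

text \<open>For \<open>j = i + 1\<close> the conjugating word is empty, giving \<open>\<lambda>\<^sub>i\<^sub>,\<^sub>i\<^sub>+\<^sub>1 = s\<^sub>i \<rho>\<^sub>i\<close>.\<close>

definition lam_elem :: "nat \<Rightarrow> nat \<Rightarrow> nat \<Rightarrow> vt_gen letter list set" where
  "lam_elem n i j = word_class (vt_gens n) (vt_rels n)
     (concat (map \<rho>_word (rev [i + 1..<j])) @ (s_word i @ \<rho>_word i) @
      concat (map \<rho>_word [i + 1..<j]))"

definition pvt_gens :: "nat \<Rightarrow> (nat \<times> nat) set" where
  "pvt_gens n = {(i, j). 1 \<le> i \<and> i < j \<and> j \<le> n}"

definition pvt_rels :: "nat \<Rightarrow> ((nat \<times> nat) letter list \<times> (nat \<times> nat) letter list) set" where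
  "pvt_rels n =
     {([Gen (i, j), Gen (k, l)], [Gen (k, l), Gen (i, j)]) | i j k l.
        (i, j) \<in> pvt_gens n \<and> (k, l) \<in> pvt_gens n \<and> distinct [i, j, k, l]}"


section \<open>Well-definedness\<close>

lemma words_simps [simp]:
  "[] \<in> words X"
  "Gen x # w \<in> words X \<longleftrightarrow> x \<in> X \<and> w \<in> words X"
  "Inv x # w \<in> words X \<longleftrightarrow> x \<in> X \<and> w \<in> words X"
  "u @ v \<in> words X \<longleftrightarrow> u \<in> words X \<and> v \<in> words X"
  by (auto simp: words_def)

lemma word_cong_words:
  "(u, v) \<in> word_cong X R \<Longrightarrow> u \<in> words X \<and> v \<in> words X"
  by (induction rule: word_cong.induct) auto

lemma equiv_word_cong: "equiv (words X) (word_cong X R)"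
  by (rule equivI)
     (auto simp: refl_on_def sym_def trans_def dest: word_cong_words intro: word_cong.intros)

lemma carrier_presented_group:
  "carrier (presented_group X R) = word_class X R ` words X"
  by (auto simp: presented_group_def word_class_def quotient_def)

lemma mult_word_class:
  assumes "u \<in> words X" "v \<in> words X"
  shows "word_class X R u \<otimes>\<^bsub>presented_group X R\<^esub> word_class X R v = word_class X R (u @ v)"
proof -
  let ?A = "word_class X R u" and ?B = "word_class X R v"
  have "word_class X R (a @ b) = word_class X R (u @ v)"
    if "a \<in> word_class X R u" "b \<in> word_class X R v" for a b
    using that unfolding word_class_def
    by (intro equiv_class_eq[OF equiv_word_cong]) (auto intro: word_cong.intros)
  then have "(\<Union>a\<in>?A. \<Union>b\<in>?B. word_class X R (a @ b)) =
      (\<Union>a\<in>?A. \<Union>b\<in>?B. word_class X R (u @ v))"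
    by (intro SUP_cong HOL.refl)
  moreover have "u \<in> ?A" "v \<in> ?B"
    using assms by (auto simp: word_class_def intro: word_cong.refl)
  then have "?A \<noteq> {}" "?B \<noteq> {}" by blast+
  ultimately show ?thesis
    by (simp add: presented_group_def)
qed

lemma one_presented_group: "\<one>\<^bsub>presented_group X R\<^esub> = word_class X R []"
  by (simp add: presented_group_def)

lemma word_cong_left_inverse:
  "w \<in> words X \<Longrightarrow> \<exists>v\<in>words X. (v @ w, []) \<in> word_cong X R"
proof (induction w)
  case Nil
  show ?case by (rule bexI[of _ "[]"]) (auto intro: word_cong.refl)
next
  case (Cons a w)
  then have "w \<in> words X" by (cases a) auto
  with Cons.IH obtain v where v: "v \<in> words X" "(v @ w, []) \<in> word_cong X R" by blast
  obtain b where b: "[b] \<in> words X" "([b, a], []) \<in> word_cong X R"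
    using Cons.prems
    by (cases a) (auto intro: word_cong.intros intro: that[of "Inv _"] that[of "Gen _"])
  have "((v @ [b, a]) @ w, (v @ []) @ w) \<in> word_cong X R"
    using v(1) \<open>w \<in> words X\<close> b(2) by (intro word_cong.append word_cong.refl) auto
  with v(2) have "((v @ [b]) @ a # w, []) \<in> word_cong X R"
    by (auto intro: word_cong.trans)
  moreover have "v @ [b] \<in> words X" using v(1) b(1) by simp
  ultimately show ?case by blast
qed

lemma group_presented_group: "group (presented_group X R)"
proof (rule groupI)
  fix x assume "x \<in> carrier (presented_group X R)"
  then obtain w where w: "w \<in> words X" "x = word_class X R w"
    by (auto simp: carrier_presented_group)
  from word_cong_left_inverse[OF w(1)] obtain v
    where v: "v \<in> words X" "(v @ w, []) \<in> word_cong X R" by blast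
  have "word_class X R v \<otimes>\<^bsub>presented_group X R\<^esub> x = \<one>\<^bsub>presented_group X R\<^esub>"
    using equiv_class_eq[OF equiv_word_cong v(2)] v(1) w
    by (simp add: mult_word_class one_presented_group) (simp add: word_class_def)
  with v(1) show "\<exists>y\<in>carrier (presented_group X R).
      y \<otimes>\<^bsub>presented_group X R\<^esub> x = \<one>\<^bsub>presented_group X R\<^esub>"
    by (auto simp: carrier_presented_group)
qed (auto simp: carrier_presented_group mult_word_class one_presented_group)

context group
begin

lemma letter_eval_closed:
  "f \<in> X \<rightarrow> carrier G \<Longrightarrow> a \<in> Gen ` X \<union> Inv ` X \<Longrightarrow> letter_eval G f a \<in> carrier G"
  by (cases a) (auto intro: funcset_mem inv_closed)

lemma word_eval_simps [simp]:
  "word_eval G f [] = \<one>"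
  "word_eval G f (a # w) = letter_eval G f a \<otimes> word_eval G f w"
  by (simp_all add: word_eval_def)

lemma word_eval_closed:
  assumes "f \<in> X \<rightarrow> carrier G" "w \<in> words X"
  shows "word_eval G f w \<in> carrier G"
  using assms(2) unfolding words_def
  by (induction w rule: lists.induct)
     (simp_all add: letter_eval_closed[OF assms(1)] del: Un_iff)

lemma word_eval_append:
  assumes f: "f \<in> X \<rightarrow> carrier G" and v: "v \<in> words X"
  shows "u \<in> words X \<Longrightarrow> word_eval G f (u @ v) = word_eval G f u \<otimes> word_eval G f v"
proof (induction u)
  case Nil
  then show ?case using word_eval_closed[OF f v] by simp
next
  case (Cons a u)
  then have "u \<in> words X" "letter_eval G f a \<in> carrier G"
    using letter_eval_closed[OF f] by (simp_all add: words_def del: Un_iff)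
  with Cons.IH show ?case
    using word_eval_closed[OF f] v by (simp add: m_assoc)
qed

lemma word_eval_cong:
  assumes f: "f \<in> X \<rightarrow> carrier G"
    and R: "\<And>l r. (l, r) \<in> R \<Longrightarrow> word_eval G f l = word_eval G f r"
    and "(u, v) \<in> word_cong X R"
  shows "word_eval G f u = word_eval G f v"
  using assms(3)
proof (induction rule: word_cong.induct)
  case (append u v u' v')
  then show ?case using word_cong_words by (metis word_eval_append[OF f])
next
  case (Gen_Inv x)
  then have "f x \<in> carrier G" using f by auto
  then show ?case by simp
next
  case (Inv_Gen x)
  then have "f x \<in> carrier G" using f by auto
  then show ?case by simp
qed (use R in auto)

lemma presented_lift_word_class:
  assumes f: "f \<in> X \<rightarrow> carrier G"
    and R: "\<And>l r. (l, r) \<in> R \<Longrightarrow> word_eval G f l = word_eval G f r"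
    and w: "w \<in> words X"
  shows "presented_lift G f (word_class X R w) = word_eval G f w"
proof -
  have "word_eval G f ` word_class X R w = {word_eval G f w}"
    using word_eval_cong[OF f R] w by (force simp: word_class_def intro: word_cong.refl)
  then show ?thesis by (simp add: presented_lift_def)
qed

lemma presented_lift_hom:
  assumes "f \<in> X \<rightarrow> carrier G"
    and "\<And>l r. (l, r) \<in> R \<Longrightarrow> word_eval G f l = word_eval G f r"
  shows "presented_lift G f \<in> hom (presented_group X R) G"
proof (rule homI)
  fix x assume "x \<in> carrier (presented_group X R)"
  then obtain u where u: "u \<in> words X" "x = word_class X R u"
    by (auto simp: carrier_presented_group)
  then have x: "presented_lift G f x = word_eval G f u"
    using presented_lift_word_class[OF assms] by blast
  then show "presented_lift G f x \<in> carrier G"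
    using word_eval_closed[OF assms(1) u(1)] by simp
  fix y assume "y \<in> carrier (presented_group X R)"
  then obtain v where v: "v \<in> words X" "y = word_class X R v"
    by (auto simp: carrier_presented_group)
  then have y: "presented_lift G f y = word_eval G f v"
    using presented_lift_word_class[OF assms] by blast
  have "u @ v \<in> words X" using u(1) v(1) by simp
  then have "presented_lift G f (word_class X R (u @ v)) = word_eval G f (u @ v)"
    using presented_lift_word_class[OF assms] by blast
  then show "presented_lift G f (x \<otimes>\<^bsub>presented_group X R\<^esub> y) =
      presented_lift G f x \<otimes> presented_lift G f y"
    unfolding x y word_eval_append[OF assms(1) v(1) u(1), symmetric]
    using u v by (simp add: mult_word_class)
qed

end

lemma vt_transp_closed: "vt_transp \<in> vt_gens n \<rightarrow> carrier (sym_group n)"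
  by (auto simp: vt_gens_def sym_group_carrier intro!: permutes_swap_id)

lemma transpose_Suc_commute:
  fixes i j :: nat
  assumes "\<bar>int i - int j\<bar> \<ge> 2"
  shows "transpose i (Suc i) \<circ> transpose j (Suc j) = transpose j (Suc j) \<circ> transpose i (Suc i)"
proof -
  have "i \<noteq> j" "i \<noteq> Suc j" "Suc i \<noteq> j" using assms by auto
  then show ?thesis by (intro ext) (simp add: transpose_def)
qed

lemma transpose_Suc_braid:
  fixes i :: nat
  shows "transpose i (Suc i) \<circ> (transpose (Suc i) (Suc (Suc i)) \<circ> transpose i (Suc i)) =
    transpose (Suc i) (Suc (Suc i)) \<circ> (transpose i (Suc i) \<circ> transpose (Suc i) (Suc (Suc i)))"
  by (intro ext) (simp add: transpose_def)

lemma vt_transp_rels: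
  assumes "(l, r) \<in> vt_rels n"
  shows "word_eval (sym_group n) vt_transp l = word_eval (sym_group n) vt_transp r"
  using assms unfolding vt_rels_def
  by (elim UnE CollectE exE conjE Pair_inject)
     (simp_all add: group.word_eval_simps[OF sym_group_is_group] sym_group_mult sym_group_one
       transpose_Suc_commute transpose_Suc_braid)

lemma vt_perm_hom: "vt_perm n \<in> hom (VT n) (sym_group n)"
  unfolding vt_perm_def VT_def
  by (rule group.presented_lift_hom[OF sym_group_is_group vt_transp_closed vt_transp_rels])

lemma vt_perm_gen:
  assumes "i \<in> {1..n - 1}"
  shows "vt_perm n (word_class (vt_gens n) (vt_rels n) (s_word i)) = transpose i (i + 1)"
    and "vt_perm n (word_class (vt_gens n) (vt_rels n) (\<rho>_word i)) = transpose i (i + 1)"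
  using assms unfolding vt_perm_def
  by (subst group.presented_lift_word_class[OF sym_group_is_group vt_transp_closed vt_transp_rels];
      auto simp: vt_gens_def group.word_eval_simps[OF sym_group_is_group] sym_group_mult
        sym_group_one)+

lemma group_PVT: "group (PVT n)"
proof -
  have "group_hom (VT n) (sym_group n) (vt_perm n)"
    using group_presented_group sym_group_is_group vt_perm_hom
    by (simp add: group_hom_def group_hom_axioms_def VT_def)
  then show ?thesis
    unfolding PVT_def
    by (metis group_hom.subgroup_kernel group_hom.axioms(1) subgroup.subgroup_is_group)
qed

end

theory Submission
  imports Defs
begin

text \<open>
  Write \<open>A\<close> for the group with the presentation in question, and put
  \<open>\<lambda>\<^sub>j\<^sub>,\<^sub>i = \<lambda>\<^sub>i\<^sub>,\<^sub>j\<inverse>\<close> for \<open>i < j\<close>. The proof rests on one observation: with this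
  convention the symmetric group acts by permuting indices, \<open>\<sigma> \<cdot> \<lambda>\<^sub>i\<^sub>,\<^sub>j = \<lambda>\<^sub>\<sigma>\<^sub>i\<^sub>,\<^sub>\<sigma>\<^sub>j\<close>, both
  on \<open>A\<close> (\<open>perm_act_signed_gen\<close>) and, with \<open>\<rho>\<^sub>k\<close> acting by conjugation, on the elements
  \<open>\<lambda>\<^sub>i\<^sub>,\<^sub>j\<close> of the virtual twin group (\<open>conj_r_signed_lam\<close>). So the virtual twin group ought to be
  the semidirect product of \<open>A\<close> and the symmetric group, with \<open>A\<close> as the kernel of the projection.

  The elements \<open>\<lambda>\<^sub>1\<^sub>,\<^sub>2\<close> and \<open>\<lambda>\<^sub>3\<^sub>,\<^sub>4\<close> of the virtual twin group commute because \<open>s\<^sub>1\<close> and \<open>\<rho>\<^sub>1\<close>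
  commute with \<open>s\<^sub>3\<close> and \<open>\<rho>\<^sub>3\<close>. The symmetric group acts transitively on quadruples of distinct
  indices, so all the defining relations of \<open>A\<close> hold (\<open>signed_lam_commute_distinct\<close>), which gives
  a homomorphism \<open>\<Psi>\<close> (\<open>pvt_iso\<close>) from \<open>A\<close> to the pure virtual twin group.

  \<open>\<Psi>\<close> is injective: sending \<open>s\<^sub>i\<close> to \<open>(\<lambda>\<^sub>i\<^sub>,\<^sub>i\<^sub>+\<^sub>1, (i i+1))\<close> and \<open>\<rho>\<^sub>i\<close> to \<open>(1, (i i+1))\<close> defines a
  homomorphism from the virtual twin group to the semidirect product whose composite with \<open>\<Psi>\<close> is
  \<open>a \<mapsto> (a, id)\<close> (\<open>vt_splitting_pvt_iso\<close>).

  \<open>\<Psi>\<close> is surjective: since \<open>s\<^sub>i = \<lambda>\<^sub>i\<^sub>,\<^sub>i\<^sub>+\<^sub>1 \<rho>\<^sub>i\<close> and the \<open>\<rho>\<^sub>k\<close> normalise the image of \<open>\<Psi>\<close>, each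
  element is a product \<open>\<Psi> a \<cdot> h\<close> with \<open>h\<close> in the subgroup generated by the \<open>\<rho>\<^sub>k\<close>
  (\<open>VT_factorization\<close>). If the product is pure, then \<open>h\<close> has trivial permutation. But the \<open>\<rho>\<^sub>k\<close>
  satisfy the Coxeter relations, which already present the symmetric group, so \<open>h = 1\<close>
  (\<open>\<pi>_injective\<close>).
\<close>


section \<open>Homomorphisms out of a presented group\<close>

lemma word_class_eqI: "(u, v) \<in> word_cong X R \<Longrightarrow> word_class X R u = word_class X R v"
  unfolding word_class_def by (rule equiv_class_eq[OF equiv_word_cong])

lemma word_class_relI:
  "(l, r) \<in> R \<Longrightarrow> l \<in> words X \<Longrightarrow> r \<in> words X \<Longrightarrow> word_class X R l = word_class X R r"
  by (intro word_class_eqI word_cong.rel)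

lemma word_class_closed: "w \<in> words X \<Longrightarrow> word_class X R w \<in> carrier (presented_group X R)"
  by (auto simp: carrier_presented_group)

lemma word_class_Inv:
  assumes "x \<in> X"
  shows "word_class X R [Inv x] = inv\<^bsub>presented_group X R\<^esub> word_class X R [Gen x]"
proof -
  interpret group "presented_group X R" by (rule group_presented_group)
  have "word_class X R [Inv x] \<otimes>\<^bsub>presented_group X R\<^esub> word_class X R [Gen x]
      = \<one>\<^bsub>presented_group X R\<^esub>"
    using assms word_class_eqI[OF word_cong.Inv_Gen[OF assms]]
    by (simp add: mult_word_class one_presented_group)
  then show ?thesis
    using assms by (intro inv_equality[symmetric]) (auto intro: word_class_closed)
qed

lemma presented_group_induct [consumes 1, case_names one gen inv]:
  assumes "a \<in> carrier (presented_group X R)"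
    and one: "P \<one>\<^bsub>presented_group X R\<^esub>"
    and gen: "\<And>x a. x \<in> X \<Longrightarrow> a \<in> carrier (presented_group X R) \<Longrightarrow> P a \<Longrightarrow>
      P (word_class X R [Gen x] \<otimes>\<^bsub>presented_group X R\<^esub> a)"
    and inv: "\<And>x a. x \<in> X \<Longrightarrow> a \<in> carrier (presented_group X R) \<Longrightarrow> P a \<Longrightarrow>
      P (inv\<^bsub>presented_group X R\<^esub> word_class X R [Gen x] \<otimes>\<^bsub>presented_group X R\<^esub> a)"
  shows "P a"
proof -
  obtain w where w: "w \<in> words X" and a: "a = word_class X R w"
    using assms(1) by (auto simp: carrier_presented_group)
  from w have "P (word_class X R w)"
  proof (induction w)
    case Nil
    then show ?case using one by (simp add: one_presented_group)
  next
    case (Cons l w)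
    then have w: "w \<in> words X" by (cases l) auto
    show ?case
    proof (cases l)
      case (Gen x)
      then have "x \<in> X" using Cons by simp
      then show ?thesis
        using gen[of x "word_class X R w"] Cons w Gen
        by (simp add: mult_word_class word_class_closed)
    next
      case (Inv x)
      then have "x \<in> X" using Cons by simp
      then show ?thesis
        using inv[of x "word_class X R w"] Cons w Inv
        by (simp add: mult_word_class word_class_closed word_class_Inv[symmetric])
    qed
  qed
  then show ?thesis by (simp add: a)
qed

lemma presented_hom_eqI:
  assumes "group H"
    and h: "h \<in> hom (presented_group X R) H" and h': "h' \<in> hom (presented_group X R) H"
    and eq: "\<And>x. x \<in> X \<Longrightarrow> h (word_class X R [Gen x]) = h' (word_class X R [Gen x])"
    and a: "a \<in> carrier (presented_group X R)"
  shows "h a = h' a"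
proof -
  interpret P: group "presented_group X R" by (rule group_presented_group)
  interpret H: group H by fact
  interpret h: group_hom "presented_group X R" H h by unfold_locales fact
  interpret h': group_hom "presented_group X R" H h' by unfold_locales fact
  show ?thesis
    using a by (induction rule: presented_group_induct) (simp_all add: eq word_class_closed)
qed

lemma (in group) presented_lift_gen:
  assumes "f \<in> X \<rightarrow> carrier G"
    and "\<And>l r. (l, r) \<in> R \<Longrightarrow> word_eval G f l = word_eval G f r" and "x \<in> X"
  shows "presented_lift G f (word_class X R [Gen x]) = f x"
proof -
  have "f x \<in> carrier G" using assms by auto
  then show ?thesis
    by (subst presented_lift_word_class[OF assms(1,2)]) (simp_all add: assms(3))
qed


section \<open>The Coxeter relations of the symmetric group\<close>

locale coxeter_relations = group G for G (structure) +
  fixes n :: nat and r :: "nat \<Rightarrow> 'a"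
  assumes r_closed [simp]: "1 \<le> i \<Longrightarrow> i < n \<Longrightarrow> r i \<in> carrier G"
    and r_square [simp]: "1 \<le> i \<Longrightarrow> i < n \<Longrightarrow> r i \<otimes> r i = \<one>"
    and r_commute: "1 \<le> i \<Longrightarrow> i + 2 \<le> j \<Longrightarrow> j < n \<Longrightarrow> r i \<otimes> r j = r j \<otimes> r i"
    and r_braid: "1 \<le> i \<Longrightarrow> Suc i < n \<Longrightarrow>
      r i \<otimes> (r (Suc i) \<otimes> r i) = r (Suc i) \<otimes> (r i \<otimes> r (Suc i))"
begin

lemma r_cancel [simp]: "1 \<le> i \<Longrightarrow> i < n \<Longrightarrow> x \<in> carrier G \<Longrightarrow> r i \<otimes> (r i \<otimes> x) = x"
  by (simp flip: m_assoc)

lemma inv_r [simp]: "1 \<le> i \<Longrightarrow> i < n \<Longrightarrow> inv (r i) = r i"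
  by (intro inv_equality) auto

text \<open>The product \<open>r\<^sub>m r\<^sub>m\<^sub>-\<^sub>1 \<cdots> r\<^sub>m\<^sub>-\<^sub>t\<^sub>+\<^sub>1\<close>. For \<open>t \<le> m\<close> these are coset representatives of the
  symmetric group on \<open>m\<close> points in the one on \<open>m + 1\<close> points: the permutation sends
  \<open>m + 1 - t\<close> to \<open>m + 1\<close>.\<close>

primrec descend :: "nat \<Rightarrow> nat \<Rightarrow> 'a" where
  "descend m 0 = \<one>"
| "descend m (Suc t) = descend m t \<otimes> r (m - t)"

lemma descend_closed [simp]: "m < n \<Longrightarrow> t \<le> m \<Longrightarrow> descend m t \<in> carrier G"
  by (induction t) auto

lemma descend_commute:
  assumes "m < n" "1 \<le> i" "i + t < m"
  shows "descend m t \<otimes> r i = r i \<otimes> descend m t"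
  using assms(3)
proof (induction t)
  case 0
  then show ?case using assms by simp
next
  case (Suc t)
  have c: "descend m t \<in> carrier G" "r i \<in> carrier G" "r (m - t) \<in> carrier G"
    using assms Suc.prems by auto
  have "descend m (Suc t) \<otimes> r i = descend m t \<otimes> (r (m - t) \<otimes> r i)"
    using c by (simp add: m_assoc)
  also have "r (m - t) \<otimes> r i = r i \<otimes> r (m - t)"
    using r_commute[of i "m - t"] assms Suc.prems by simp
  also have "descend m t \<otimes> (r i \<otimes> r (m - t)) = r i \<otimes> descend m (Suc t)"
    using c Suc by (simp flip: m_assoc)
  finally show ?case .
qed

text \<open>The letter \<open>r\<^sub>i\<^sub>+\<^sub>1\<close> commutes leftwards past the letters \<open>r\<^sub>j\<close> with \<open>j < i\<close>; the braid relation
  then turns \<open>r\<^sub>i\<^sub>+\<^sub>1 r\<^sub>i r\<^sub>i\<^sub>+\<^sub>1\<close> into \<open>r\<^sub>i r\<^sub>i\<^sub>+\<^sub>1 r\<^sub>i\<close>, whose first letter commutes with everything further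
  to the left.\<close>

lemma descend_shift:
  assumes "m < n" "Suc i \<le> m" "t \<le> m" "m < i + t"
  shows "descend m t \<otimes> r (Suc i) = r i \<otimes> descend m t"
  using assms(3,4)
proof (induction t)
  case 0
  then show ?case using assms by simp
next
  case (Suc t)
  have i: "1 \<le> i" using Suc.prems by simp
  have c: "descend m t \<in> carrier G" "r i \<in> carrier G" "r (Suc i) \<in> carrier G"
      "r (m - t) \<in> carrier G"
    using assms(1,2) Suc.prems i by auto
  show ?case
  proof (cases "m - t = i")
    case True
    then obtain v where v: "t = Suc v" using assms(2) by (cases t) auto
    then have mv: "m - v = Suc i" using True assms(2) Suc.prems(1) by simp
    have cv: "descend m v \<in> carrier G" using assms(1) Suc.prems v by simp
    have "descend m (Suc t) \<otimes> r (Suc i) = descend m v \<otimes> (r (Suc i) \<otimes> (r i \<otimes> r (Suc i)))"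
      using True v mv c cv by (simp add: m_assoc)
    also have "r (Suc i) \<otimes> (r i \<otimes> r (Suc i)) = r i \<otimes> (r (Suc i) \<otimes> r i)"
      using r_braid[of i] assms(1,2) i by simp
    also have "descend m v \<otimes> (r i \<otimes> (r (Suc i) \<otimes> r i)) =
        (descend m v \<otimes> r i) \<otimes> (r (Suc i) \<otimes> r i)"
      using c cv by (simp add: m_assoc)
    also have "descend m v \<otimes> r i = r i \<otimes> descend m v"
      using descend_commute[of m i v] assms(1) i mv by simp
    also have "(r i \<otimes> descend m v) \<otimes> (r (Suc i) \<otimes> r i) = r i \<otimes> descend m (Suc t)"
      using True v mv c cv by (simp add: m_assoc)
    finally show ?thesis .
  next
    case False
    have "descend m (Suc t) \<otimes> r (Suc i) = descend m t \<otimes> (r (m - t) \<otimes> r (Suc i))"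
      using c by (simp add: m_assoc)
    also have "r (m - t) \<otimes> r (Suc i) = r (Suc i) \<otimes> r (m - t)"
      using r_commute[of "m - t" "Suc i"] assms(1,2) Suc.prems False by simp
    also have "descend m t \<otimes> (r (Suc i) \<otimes> r (m - t)) = r i \<otimes> descend m (Suc t)"
      using Suc False c by (simp flip: m_assoc)
    finally show ?thesis .
  qed
qed

lemma r_generate_closed: "m < n \<Longrightarrow> h \<in> generate G (r ` {1..m}) \<Longrightarrow> h \<in> carrier G"
  by (rule generate_in_carrier[of "r ` {1..m}"]) auto

text \<open>The products \<open>h' \<cdot> descend\<close> are closed under right multiplication by each generator \<open>r\<^sub>i\<close>. It
  lengthens or shortens the descending factor if \<open>i\<close> is next to or equal to its last index;
  otherwise it moves to the left of that factor, where its index is at most \<open>m\<close>.\<close>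

lemma generate_r_decompose:
  assumes m: "Suc m < n" and h: "h \<in> generate G (r ` {1..Suc m})"
  shows "\<exists>h' \<in> generate G (r ` {1..m}). \<exists>t \<le> Suc m. h = h' \<otimes> descend (Suc m) t"
proof -
  define D where "D = {h' \<otimes> descend (Suc m) t | h' t. h' \<in> generate G (r ` {1..m}) \<and> t \<le> Suc m}"
  have D_closed: "x \<in> carrier G" if "x \<in> D" for x
    using that m r_generate_closed[of m] by (auto simp: D_def)
  have gen: "r i \<in> generate G (r ` {1..m})" if "1 \<le> i" "i \<le> m" for i
    using that by (intro generate.incl) auto
  have step: "x \<otimes> r i \<in> D" if x: "x \<in> D" and i: "1 \<le> i" "i \<le> Suc m" for x i
  proof -
    obtain h' t where h': "h' \<in> generate G (r ` {1..m})" and t: "t \<le> Suc m"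
      and x: "x = h' \<otimes> descend (Suc m) t"
      using x by (auto simp: D_def)
    have c: "h' \<in> carrier G" "descend (Suc m) t \<in> carrier G" "r i \<in> carrier G"
      using h' t i m r_generate_closed[of m] by auto
    have pull: "x \<otimes> r i \<in> D"
      if j: "1 \<le> j" "j \<le> m" "descend (Suc m) t \<otimes> r i = r j \<otimes> descend (Suc m) t" for j
    proof -
      have "x \<otimes> r i = (h' \<otimes> r j) \<otimes> descend (Suc m) t"
        using c j m x by (simp add: m_assoc)
      moreover have "h' \<otimes> r j \<in> generate G (r ` {1..m})"
        using h' gen j by (intro generate.eng) auto
      ultimately show ?thesis using t by (auto simp: D_def)
    qed
    consider "i + t = Suc m" | "i + t = Suc (Suc m)" | "i + t < Suc m" | "Suc (Suc m) < i + t"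
      by linarith
    then show ?thesis
    proof cases
      case 1
      then have "Suc m - t = i" by simp
      then have "x \<otimes> r i = h' \<otimes> descend (Suc m) (Suc t)"
        using c x by (simp add: m_assoc)
      then show ?thesis
        unfolding D_def using h' 1 i
        by (intro CollectI exI[of _ h'] exI[of _ "Suc t"]) simp
    next
      case 2
      then obtain v where v: "t = Suc v" "Suc m - v = i" using i by (cases t) auto
      then have "descend (Suc m) v \<in> carrier G" using m t by simp
      then have "x \<otimes> r i = h' \<otimes> descend (Suc m) v"
        using c x v i m by (simp add: m_assoc)
      then show ?thesis
        unfolding D_def using h' v t
        by (intro CollectI exI[of _ h'] exI[of _ v]) simp
    next
      case 3
      then show ?thesis
        using pull[of i] descend_commute[of "Suc m" i t] i m by simp
    next
      case 4
      then obtain j where "i = Suc j" "1 \<le> j" using t i by (cases i) auto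
      then show ?thesis
        using pull[of j] descend_shift[of "Suc m" j t] 4 i m t by simp
    qed
  qed
  have "\<forall>x\<in>D. x \<otimes> h \<in> D"
    using h
  proof (induction rule: generate.induct)
    case one
    then show ?case using D_closed by simp
  next
    case (eng h1 h2)
    have "h1 \<in> carrier G" "h2 \<in> carrier G"
      using eng r_generate_closed[OF m] by auto
    then show ?case using eng D_closed by (simp flip: m_assoc)
  qed (use step m in auto)
  moreover have "\<one> \<in> D"
    by (auto simp: D_def intro!: exI[of _ \<one>] exI[of _ 0] generate.one)
  moreover have "h \<in> carrier G" using r_generate_closed[OF m h] .
  ultimately have "h \<in> D" by fastforce
  then show ?thesis by (auto simp: D_def)
qed

context
  fixes \<pi>
  assumes \<pi>: "group_hom G (sym_group n) \<pi>"
    and \<pi>_r: "\<And>i. 1 \<le> i \<Longrightarrow> i < n \<Longrightarrow> \<pi> (r i) = transpose i (Suc i)"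
begin

interpretation \<pi>: group_hom G "sym_group n" \<pi> by (rule \<pi>)

lemma \<pi>_generate_fixes:
  assumes "m < n" "h \<in> generate G (r ` {1..m})" "Suc m < k"
  shows "\<pi> h k = k"
  using assms(2)
proof (induction rule: generate.induct)
  case one
  then show ?case by (simp add: sym_group_one)
next
  case (eng h1 h2)
  then show ?case using r_generate_closed[OF assms(1)] by (simp add: sym_group_mult)
qed (use assms in \<open>auto simp: \<pi>_r\<close>)

lemma \<pi>_descend:
  "m < n \<Longrightarrow> t \<le> m \<Longrightarrow> \<pi> (descend m t) (Suc m - t) = Suc m"
proof (induction t)
  case 0
  then show ?case by (simp add: sym_group_one)
next
  case (Suc t)
  then show ?case by (simp add: sym_group_mult \<pi>_r Suc_diff_le)
qed

text \<open>In the decomposition \<open>h' \<cdot> descend\<close> the factor \<open>h'\<close> fixes the last point, so the point that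
  \<open>h\<close> sends to the last one determines the descending factor. If the permutation of \<open>h\<close> is
  trivial, this factor is empty and \<open>h\<close> lies in the subgroup for one point fewer.\<close>

lemma \<pi>_injective:
  "m < n \<Longrightarrow> h \<in> generate G (r ` {1..m}) \<Longrightarrow> \<pi> h = id \<Longrightarrow> h = \<one>"
proof (induction m)
  case 0
  then show ?case by (simp add: generate_empty)
next
  case (Suc m)
  obtain h' t where h': "h' \<in> generate G (r ` {1..m})" and t: "t \<le> Suc m"
    and h: "h = h' \<otimes> descend (Suc m) t"
    using generate_r_decompose[OF Suc.prems(1,2)] by blast
  have c: "h' \<in> carrier G" using r_generate_closed[OF _ h'] Suc.prems(1) by simp
  \<comment> \<open>Evaluating \<open>\<pi> h = id\<close> at the point that the descending factor sends to \<open>m + 2\<close>.\<close>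
  have "Suc (Suc m) - t = \<pi> h (Suc (Suc m) - t)" using Suc.prems(3) by simp
  also have "\<dots> = \<pi> h' (Suc (Suc m))"
    using \<pi>_descend[of "Suc m" t] Suc.prems(1) t c by (simp add: h sym_group_mult)
  also have "\<dots> = Suc (Suc m)"
    using \<pi>_generate_fixes[OF _ h'] Suc.prems(1) by simp
  finally have "t = 0" using t by simp
  then have "h = h'" using h c by simp
  then show ?case using Suc h' by simp
qed

end

end


section \<open>The pure generators of a virtual twin group\<close>

lemma transpose_eq_iff: "transpose a b x = transpose a b y \<longleftrightarrow> x = y"
  by (metis transpose_involutory)

lemma transpose_closed: "a \<in> S \<Longrightarrow> b \<in> S \<Longrightarrow> x \<in> S \<Longrightarrow> transpose a b x \<in> S"
  by (simp add: transpose_def)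

locale virtual_twin_relations = coxeter_relations +
  fixes s :: "nat \<Rightarrow> 'a"
  assumes s_closed [simp]: "1 \<le> i \<Longrightarrow> i < n \<Longrightarrow> s i \<in> carrier G"
    and s_square [simp]: "1 \<le> i \<Longrightarrow> i < n \<Longrightarrow> s i \<otimes> s i = \<one>"
    and s_commute: "1 \<le> i \<Longrightarrow> i + 2 \<le> j \<Longrightarrow> j < n \<Longrightarrow> s i \<otimes> s j = s j \<otimes> s i"
    and rs_commute: "1 \<le> i \<Longrightarrow> i < n \<Longrightarrow> 1 \<le> j \<Longrightarrow> j < n \<Longrightarrow> i + 2 \<le> j \<or> j + 2 \<le> i \<Longrightarrow>
      r i \<otimes> s j = s j \<otimes> r i"
    and rrs_mixed: "1 \<le> i \<Longrightarrow> Suc i < n \<Longrightarrow>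
      r i \<otimes> (r (Suc i) \<otimes> s i) = s (Suc i) \<otimes> (r i \<otimes> r (Suc i))"
begin

lemma inv_s [simp]: "1 \<le> i \<Longrightarrow> i < n \<Longrightarrow> inv (s i) = s i"
  by (intro inv_equality) auto

text \<open>Conjugation by \<open>r\<^sub>k\<close>, written with \<open>r\<^sub>k\<close> in place of its inverse because \<open>r\<^sub>k\<close> is an
  involution.\<close>

definition conj_r :: "nat \<Rightarrow> 'a \<Rightarrow> 'a" where
  "conj_r k x = r k \<otimes> (x \<otimes> r k)"

lemma conj_r_closed [simp]:
  "1 \<le> k \<Longrightarrow> k < n \<Longrightarrow> x \<in> carrier G \<Longrightarrow> conj_r k x \<in> carrier G"
  by (simp add: conj_r_def)

lemma conj_r_involution [simp]:
  "1 \<le> k \<Longrightarrow> k < n \<Longrightarrow> x \<in> carrier G \<Longrightarrow> conj_r k (conj_r k x) = x"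
  by (simp add: conj_r_def m_assoc)

lemma conj_r_mult:
  "1 \<le> k \<Longrightarrow> k < n \<Longrightarrow> x \<in> carrier G \<Longrightarrow> y \<in> carrier G \<Longrightarrow>
    conj_r k (x \<otimes> y) = conj_r k x \<otimes> conj_r k y"
  by (simp add: conj_r_def m_assoc)

lemma conj_r_inv:
  "1 \<le> k \<Longrightarrow> k < n \<Longrightarrow> x \<in> carrier G \<Longrightarrow> conj_r k (inv x) = inv (conj_r k x)"
  by (simp add: conj_r_def inv_mult_group m_assoc)

lemma conj_r_id:
  "1 \<le> k \<Longrightarrow> k < n \<Longrightarrow> x \<in> carrier G \<Longrightarrow> r k \<otimes> x = x \<otimes> r k \<Longrightarrow> conj_r k x = x"
  by (simp add: conj_r_def flip: m_assoc) (simp add: m_assoc)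

lemma conj_r_commute:
  assumes "1 \<le> i" "i < n" "1 \<le> j" "j < n" "i + 2 \<le> j \<or> j + 2 \<le> i" "x \<in> carrier G"
  shows "conj_r i (conj_r j x) = conj_r j (conj_r i x)"
proof -
  have eq: "r i \<otimes> r j = r j \<otimes> r i"
    using r_commute[of i j] r_commute[of j i] assms by auto
  have "conj_r i (conj_r j x) = (r i \<otimes> r j) \<otimes> x \<otimes> (r j \<otimes> r i)"
    using assms by (simp add: conj_r_def m_assoc)
  also have "\<dots> = (r j \<otimes> r i) \<otimes> x \<otimes> (r i \<otimes> r j)" by (simp add: eq)
  also have "\<dots> = conj_r j (conj_r i x)"
    using assms by (simp add: conj_r_def m_assoc)
  finally show ?thesis .
qed

lemma conj_r_braid:
  assumes "1 \<le> i" "Suc i < n" "x \<in> carrier G"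
  shows "conj_r i (conj_r (Suc i) (conj_r i x)) = conj_r (Suc i) (conj_r i (conj_r (Suc i) x))"
proof -
  have "conj_r i (conj_r (Suc i) (conj_r i x)) =
      (r i \<otimes> (r (Suc i) \<otimes> r i)) \<otimes> x \<otimes> (r i \<otimes> (r (Suc i) \<otimes> r i))"
    using assms by (simp add: conj_r_def m_assoc)
  also have "\<dots> = (r (Suc i) \<otimes> (r i \<otimes> r (Suc i))) \<otimes> x \<otimes> (r (Suc i) \<otimes> (r i \<otimes> r (Suc i)))"
    using assms by (simp add: r_braid)
  also have "\<dots> = conj_r (Suc i) (conj_r i (conj_r (Suc i) x))"
    using assms by (simp add: conj_r_def m_assoc)
  finally show ?thesis .
qed

text \<open>Meaningful only for \<open>i < j\<close>. The recursion peels off the outermost conjugation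
  \<open>\<lambda>\<^sub>i\<^sub>,\<^sub>j\<^sub>+\<^sub>1 = \<rho>\<^sub>j \<lambda>\<^sub>i\<^sub>,\<^sub>j \<rho>\<^sub>j\<close>.\<close>

primrec lam :: "nat \<Rightarrow> nat \<Rightarrow> 'a" where
  "lam i 0 = \<one>"
| "lam i (Suc j) = (if j = i then s i \<otimes> r i else conj_r j (lam i j))"

text \<open>The elements \<open>\<lambda>\<^sub>i\<^sub>,\<^sub>j\<close> for all ordered pairs of distinct indices. The inverse for \<open>j < i\<close> is forced
  by \<open>\<rho>\<^sub>i (s\<^sub>i \<rho>\<^sub>i) \<rho>\<^sub>i = \<rho>\<^sub>i s\<^sub>i = (s\<^sub>i \<rho>\<^sub>i)\<inverse>\<close>.\<close>

definition signed_lam :: "nat \<Rightarrow> nat \<Rightarrow> 'a" where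
  "signed_lam i j = (if i < j then lam i j else inv (lam j i))"

lemma lam_closed [simp]: "1 \<le> i \<Longrightarrow> i < j \<Longrightarrow> j \<le> n \<Longrightarrow> lam i j \<in> carrier G"
  by (induction j) auto

lemma signed_lam_closed [simp]:
  "i \<in> {1..n} \<Longrightarrow> j \<in> {1..n} \<Longrightarrow> i \<noteq> j \<Longrightarrow> signed_lam i j \<in> carrier G"
  by (auto simp: signed_lam_def)

lemma conj_r_lam_outside:
  assumes "1 \<le> i" "i < j" "j \<le> n" "1 \<le> k" "k < n" "Suc k < i \<or> j < k"
  shows "conj_r k (lam i j) = lam i j"
  using assms(2,3,6)
proof (induction j)
  case 0
  then show ?case by simp
next
  case (Suc j)
  show ?case
  proof (cases "j = i")
    case True
    have "r k \<otimes> r i = r i \<otimes> r k"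
      using r_commute[of i k] r_commute[of k i] assms Suc.prems True by auto
    moreover have "r k \<otimes> s i = s i \<otimes> r k"
      using rs_commute[of k i] assms Suc.prems True by auto
    ultimately have "conj_r k (s i) = s i" "conj_r k (r i) = r i"
      using assms Suc.prems True by (auto intro!: conj_r_id)
    then show ?thesis using True assms Suc.prems by (simp add: conj_r_mult)
  next
    case False
    then have "conj_r k (lam i (Suc j)) = conj_r j (conj_r k (lam i j))"
      using conj_r_commute[of k j "lam i j"] assms Suc.prems by auto
    then show ?thesis using Suc False by auto
  qed
qed

text \<open>For \<open>j = i + 2\<close> this is the mixed relation combined with the braid relation; larger \<open>j\<close> only add
  conjugations by \<open>\<rho>\<^sub>k\<close> with \<open>k \<ge> i + 2\<close>, which commute with \<open>\<rho>\<^sub>i\<close>.\<close>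

lemma conj_r_lam_left:
  assumes "1 \<le> i" "Suc i < j" "j \<le> n"
  shows "conj_r i (lam (Suc i) j) = lam i j"
  using assms(2,3)
proof (induction j)
  case 0
  then show ?case by simp
next
  case (Suc j)
  show ?case
  proof (cases "j = Suc i")
    case True
    then have i: "Suc i < n" using Suc.prems by simp
    have "conj_r i (lam (Suc i) (Suc j)) = r i \<otimes> s (Suc i) \<otimes> (r (Suc i) \<otimes> r i)"
      using True i assms(1) by (simp add: conj_r_def m_assoc)
    \<comment> \<open>Insert \<open>1 = (r\<^sub>i r\<^sub>i\<^sub>+\<^sub>1) (r\<^sub>i\<^sub>+\<^sub>1 r\<^sub>i)\<close> after \<open>s\<^sub>i\<^sub>+\<^sub>1\<close> to expose both relations.\<close>
    also have "\<dots> = r i \<otimes> (s (Suc i) \<otimes> (r i \<otimes> r (Suc i))) \<otimes> (r (Suc i) \<otimes> (r i \<otimes> (r (Suc i) \<otimes> r i)))"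
      using i assms(1) by (simp add: m_assoc)
    also have "\<dots> = r i \<otimes> (r i \<otimes> (r (Suc i) \<otimes> s i)) \<otimes> (r (Suc i) \<otimes> (r (Suc i) \<otimes> (r i \<otimes> r (Suc i))))"
      using i assms(1) by (simp only: rrs_mixed r_braid)
    also have "\<dots> = lam i (Suc j)"
      using True i assms(1) by (simp add: conj_r_def m_assoc)
    finally show ?thesis .
  next
    case False
    then have "conj_r i (lam (Suc i) (Suc j)) = conj_r j (conj_r i (lam (Suc i) j))"
      using conj_r_commute[of i j "lam (Suc i) j"] assms Suc.prems by auto
    then show ?thesis using Suc False by simp
  qed
qed

text \<open>For \<open>j = k + 2\<close> the braid relation moves the conjugation by \<open>\<rho>\<^sub>k\<close> past those by \<open>\<rho>\<^sub>k\<^sub>+\<^sub>1\<close> and \<open>\<rho>\<^sub>k\<close>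
  that build \<open>\<lambda>\<^sub>i\<^sub>,\<^sub>j\<close> from \<open>\<lambda>\<^sub>i\<^sub>,\<^sub>k\<close>, where it becomes a conjugation by \<open>\<rho>\<^sub>k\<^sub>+\<^sub>1\<close>, which fixes
  \<open>\<lambda>\<^sub>i\<^sub>,\<^sub>k\<close>.\<close>

lemma conj_r_lam_inside:
  assumes "1 \<le> i" "i < k" "Suc k < j" "j \<le> n"
  shows "conj_r k (lam i j) = lam i j"
  using assms(3,4)
proof (induction j)
  case 0
  then show ?case by simp
next
  case (Suc j)
  show ?case
  proof (cases "j = Suc k")
    case True
    have "conj_r k (lam i (Suc j)) = conj_r (Suc k) (conj_r k (conj_r (Suc k) (lam i k)))"
      using True assms Suc.prems by (simp add: conj_r_braid)
    also have "conj_r (Suc k) (lam i k) = lam i k"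
      using conj_r_lam_outside[of i k "Suc k"] True assms Suc.prems by simp
    finally show ?thesis using True assms by simp
  next
    case False
    then have "conj_r k (lam i (Suc j)) = conj_r j (conj_r k (lam i j))"
      using conj_r_commute[of k j "lam i j"] assms Suc.prems by auto
    then show ?thesis using Suc False assms by auto
  qed
qed

lemma conj_r_lam:
  assumes "1 \<le> i" "i < j" "j \<le> n" "1 \<le> k" "k < n"
  shows "conj_r k (lam i j) = signed_lam (transpose k (Suc k) i) (transpose k (Suc k) j)"
proof -
  consider "Suc k < i" | "j < k" | "Suc k = i" | "k = j" | "k = i" "j = Suc i"
    | "k = i" "Suc i < j" | "i < k" "Suc k = j" | "i < k" "Suc k < j"
    using assms by linarith
  then show ?thesis
  proof cases
    case 1
    then show ?thesis
      using assms conj_r_lam_outside[of i j k] by (simp add: signed_lam_def transpose_def)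
  next
    case 2
    then show ?thesis
      using assms conj_r_lam_outside[of i j k] by (simp add: signed_lam_def transpose_def)
  next
    case 3
    then have "conj_r k (lam i j) = lam k j" using assms conj_r_lam_left[of k j] by auto
    then show ?thesis using 3 assms by (auto simp: signed_lam_def transpose_def)
  next
    case 4
    then show ?thesis using assms by (simp add: signed_lam_def transpose_def)
  next
    case 5
    have "conj_r k (lam i j) = r i \<otimes> s i"
      using 5 assms by (simp add: conj_r_def m_assoc)
    also have "\<dots> = inv (lam i j)" using 5 assms by (simp add: inv_mult_group)
    finally show ?thesis using 5 by (simp add: signed_lam_def)
  next
    case 6
    then have "conj_r k (lam i j) = conj_r i (conj_r i (lam (Suc i) j))"
      using conj_r_lam_left[of i j] assms by simp
    also have "\<dots> = lam (Suc i) j" using 6 assms by (intro conj_r_involution lam_closed) auto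
    finally show ?thesis using 6 by (simp add: signed_lam_def transpose_def)
  next
    case 7
    then have "lam i j = conj_r k (lam i k)" using assms by auto
    then have "conj_r k (lam i j) = lam i k" using 7 assms by simp
    then show ?thesis using 7 by (simp add: signed_lam_def transpose_def)
  next
    case 8
    then show ?thesis
      using assms conj_r_lam_inside[of i k j] by (simp add: signed_lam_def transpose_def)
  qed
qed

lemma signed_lam_swap: "i \<in> {1..n} \<Longrightarrow> j \<in> {1..n} \<Longrightarrow> i \<noteq> j \<Longrightarrow> signed_lam j i = inv (signed_lam i j)"
  by (auto simp: signed_lam_def)

lemma transpose_Suc_in:
  "1 \<le> k \<Longrightarrow> k < n \<Longrightarrow> i \<in> {1..n} \<Longrightarrow> transpose k (Suc k) i \<in> {1..n}"
  by (auto simp: transpose_def)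

lemma conj_r_slam:
  assumes "i \<in> {1..n}" "j \<in> {1..n}" "i \<noteq> j" "1 \<le> k" "k < n"
  shows "conj_r k (signed_lam i j) = signed_lam (transpose k (Suc k) i) (transpose k (Suc k) j)"
proof (cases "i < j")
  case True
  then show ?thesis using conj_r_lam[of i j k] assms by (simp add: signed_lam_def)
next
  case False
  let ?t = "transpose k (Suc k)"
  have "conj_r k (signed_lam i j) = inv (conj_r k (lam j i))"
    using assms False by (simp add: signed_lam_def conj_r_inv)
  also have "\<dots> = inv (signed_lam (?t j) (?t i))"
    using conj_r_lam[of j i k] assms False by simp
  also have "\<dots> = signed_lam (?t i) (?t j)"
    using signed_lam_swap[of "?t j" "?t i"] assms transpose_Suc_in by (simp add: transpose_eq_iff)
  finally show ?thesis .
qed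

definition signed_lam_commute :: "nat \<Rightarrow> nat \<Rightarrow> nat \<Rightarrow> nat \<Rightarrow> bool" where
  "signed_lam_commute i j k l \<longleftrightarrow> signed_lam i j \<otimes> signed_lam k l = signed_lam k l \<otimes> signed_lam i j"

lemma signed_lam_commute_transpose_Suc:
  assumes "{i, j, k, l} \<subseteq> {1..n}" "distinct [i, j, k, l]" "1 \<le> a" "a < n" "signed_lam_commute i j k l"
  defines "t \<equiv> transpose a (Suc a)"
  shows "signed_lam_commute (t i) (t j) (t k) (t l)"
proof -
  have c: "signed_lam i j \<in> carrier G" "signed_lam k l \<in> carrier G" using assms(1,2) by auto
  have "signed_lam (t i) (t j) = conj_r a (signed_lam i j)" "signed_lam (t k) (t l) = conj_r a (signed_lam k l)"
    unfolding t_def using assms(1-4) by (auto simp: conj_r_slam)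
  then show ?thesis
    using assms(3,4,5) c unfolding signed_lam_commute_def by (simp flip: conj_r_mult)
qed

text \<open>An arbitrary transposition is a product of adjacent ones, by
  \<open>(a b+1) = (b b+1) (a b) (b b+1)\<close>.\<close>

lemma signed_lam_commute_transpose:
  assumes "{i, j, k, l} \<subseteq> {1..n}" "distinct [i, j, k, l]" "1 \<le> a" "a < b" "b \<le> n"
    "signed_lam_commute i j k l"
  shows "signed_lam_commute (transpose a b i) (transpose a b j) (transpose a b k) (transpose a b l)"
  using assms(4,5,1,2,6)
proof (induction b arbitrary: i j k l)
  case 0
  then show ?case by simp
next
  case (Suc b)
  show ?case
  proof (cases "b = a")
    case True
    then show ?thesis using signed_lam_commute_transpose_Suc[of i j k l a] assms(3) Suc.prems by simp
  next
    case False
    let ?t = "transpose b (Suc b)" and ?u = "transpose a b"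
    have b: "1 \<le> b" "b < n" "a < b" using False assms(3) Suc.prems by auto
    have eq: "transpose a (Suc b) x = ?t (?u (?t x))" for x
      using b by (simp add: transpose_def)
    have t_in: "?t x \<in> {1..n} \<longleftrightarrow> x \<in> {1..n}" for x
      using b by (auto simp: transpose_def)
    have u_in: "?u x \<in> {1..n} \<longleftrightarrow> x \<in> {1..n}" for x
      using b assms(3) by (auto simp: transpose_def)
    have "signed_lam_commute (?t i) (?t j) (?t k) (?t l)"
      using signed_lam_commute_transpose_Suc[of i j k l b] b Suc.prems by simp
    then have "signed_lam_commute (?u (?t i)) (?u (?t j)) (?u (?t k)) (?u (?t l))"
      using b Suc.prems t_in by (intro Suc.IH) (auto simp: transpose_eq_iff)
    then show ?thesis
      unfolding eq using b Suc.prems t_in u_in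
      by (intro signed_lam_commute_transpose_Suc) (auto simp: transpose_eq_iff)
  qed
qed

lemma signed_lam_commute_iff_transpose:
  assumes "{i, j, k, l} \<subseteq> {1..n}" "distinct [i, j, k, l]" "a \<in> {1..n}" "b \<in> {1..n}"
  defines "t \<equiv> transpose a b"
  shows "signed_lam_commute (t i) (t j) (t k) (t l) \<Longrightarrow> signed_lam_commute i j k l"
proof -
  assume *: "signed_lam_commute (t i) (t j) (t k) (t l)"
  have tt: "t (t x) = x" for x by (simp add: t_def)
  have in_n: "{t i, t j, t k, t l} \<subseteq> {1..n}" 
    using assms(1,3,4) by (simp add: t_def transpose_closed del: atLeastAtMost_iff)
  have dist: "distinct [t i, t j, t k, t l]" using assms(2) by (simp add: t_def transpose_eq_iff)
  consider "a < b" | "a = b" | "b < a" by linarith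
  then show ?thesis
  proof cases
    case 1
    then show ?thesis
      using signed_lam_commute_transpose[OF in_n dist _ 1 _ *] assms(3,4) tt by (simp add: t_def)
  next
    case 2
    then show ?thesis using * by (simp add: t_def)
  next
    case 3
    then show ?thesis
      using signed_lam_commute_transpose[OF in_n dist _ 3 _ *] assms(3,4) tt
      by (simp add: t_def transpose_commute[of b a])
  qed
qed

lemma signed_lam_commute_1234: "4 \<le> n \<Longrightarrow> signed_lam_commute 1 2 3 4"
proof -
  assume n: "4 \<le> n"
  define a b c d where abcd: "a = s 1" "b = r 1" "c = s 3" "d = r 3"
  have closed: "a \<in> carrier G" "b \<in> carrier G" "c \<in> carrier G" "d \<in> carrier G"
    using n by (auto simp: abcd)
  have ac: "a \<otimes> c = c \<otimes> a" and bd: "b \<otimes> d = d \<otimes> b"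
    and da: "d \<otimes> a = a \<otimes> d" and bc: "b \<otimes> c = c \<otimes> b"
    using n s_commute[of 1 3] r_commute[of 1 3] rs_commute[of 1 3] rs_commute[of 3 1]
    by (auto simp: abcd)
  have "(a \<otimes> b) \<otimes> (c \<otimes> d) = a \<otimes> (b \<otimes> c) \<otimes> d" using closed by (simp add: m_assoc)
  also have "\<dots> = (a \<otimes> c) \<otimes> (b \<otimes> d)" using closed by (simp add: bc m_assoc)
  also have "\<dots> = c \<otimes> (a \<otimes> d) \<otimes> b" using closed by (simp add: ac bd m_assoc)
  also have "\<dots> = (c \<otimes> d) \<otimes> (a \<otimes> b)" using closed by (simp flip: da add: m_assoc)
  finally show ?thesis
    by (simp add: signed_lam_commute_def signed_lam_def abcd numeral_2_eq_2 numeral_3_eq_3 numeral_eq_Suc)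
qed

text \<open>Transpositions move \<open>i\<close>, \<open>j\<close>, \<open>k\<close>, \<open>l\<close> one after the other to \<open>1\<close>, \<open>2\<close>, \<open>3\<close>, \<open>4\<close>, each fixing the
  indices that are already in place.\<close>

lemma signed_lam_commute_distinct:
  assumes "{i, j, k, l} \<subseteq> {1..n}" "distinct [i, j, k, l]"
  shows "signed_lam_commute i j k l"
proof -
  have "card {i, j, k, l} \<le> card {1..n}" using assms(1) by (intro card_mono) auto
  then have n: "4 \<le> n" using assms(2) by simp
  have 3: "signed_lam_commute 1 2 3 l" if "l \<in> {1..n}" "distinct [1, 2, 3, l]" for l
    using that n signed_lam_commute_1234
    by (intro signed_lam_commute_iff_transpose[of 1 2 3 l l 4]) (simp_all add: transpose_apply_other)
  have 2: "signed_lam_commute 1 2 k l" if "{k, l} \<subseteq> {1..n}" "distinct [1, 2, k, l]" for k l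
  proof (intro signed_lam_commute_iff_transpose[of 1 2 k l k 3])
    let ?t = "transpose k 3"
    have t: "?t 1 = 1" "?t 2 = 2" "?t k = 3"
      using that by (auto simp: transpose_apply_other)
    have "?t l \<in> {1..n}" using that n by (intro transpose_closed) auto
    moreover have "distinct (map ?t [1, 2, k, l])"
      using that(2) unfolding distinct_map by (auto simp: inj_on_def transpose_eq_iff)
    ultimately show "signed_lam_commute (?t 1) (?t 2) (?t k) (?t l)" using t 3[of "?t l"] by simp
  qed (use that n in auto)
  have 1: "signed_lam_commute 1 j k l" if "{j, k, l} \<subseteq> {1..n}" "distinct [1, j, k, l]" for j k l
  proof (intro signed_lam_commute_iff_transpose[of 1 j k l j 2])
    let ?t = "transpose j 2"
    have t: "?t 1 = 1" "?t j = 2" using that by (auto simp: transpose_apply_other)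
    have "?t k \<in> {1..n}" "?t l \<in> {1..n}" using that n by (intro transpose_closed; auto)+
    moreover have "distinct (map ?t [1, j, k, l])"
      using that(2) unfolding distinct_map by (auto simp: inj_on_def transpose_eq_iff)
    ultimately show "signed_lam_commute (?t 1) (?t j) (?t k) (?t l)"
      using t 2[of "?t k" "?t l"] by simp
  qed (use that n in auto)
  show ?thesis
  proof (intro signed_lam_commute_iff_transpose[of i j k l i 1])
    let ?t = "transpose i 1"
    have t: "?t i = 1" by simp
    have "?t j \<in> {1..n}" "?t k \<in> {1..n}" "?t l \<in> {1..n}"
      using assms n by (intro transpose_closed; auto)+
    moreover have "distinct (map ?t [i, j, k, l])"
      using assms(2) unfolding distinct_map by (auto simp: inj_on_def transpose_eq_iff)
    ultimately show "signed_lam_commute (?t i) (?t j) (?t k) (?t l)"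
      using t 1[of "?t j" "?t k" "?t l"] by simp
  qed (use assms n in auto)
qed

end

section \<open>The symmetric group acting on the presented group\<close>

lemma (in group) commute_inv:
  assumes "x \<in> carrier G" "y \<in> carrier G" "x \<otimes> y = y \<otimes> x"
  shows "inv x \<otimes> y = y \<otimes> inv x"
proof -
  have "inv x \<otimes> y = inv x \<otimes> (y \<otimes> x) \<otimes> inv x" using assms(1,2) by (simp add: m_assoc)
  also have "\<dots> = y \<otimes> inv x" using assms(1,2) by (simp flip: assms(3) m_assoc)
  finally show ?thesis .
qed

abbreviation pvt_presented :: "nat \<Rightarrow> (nat \<times> nat) letter list set monoid" where
  "pvt_presented n \<equiv> presented_group (pvt_gens n) (pvt_rels n)"

interpretation pvt: group "pvt_presented n" for n
  by (rule group_presented_group)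

abbreviation pvt_gen :: "nat \<Rightarrow> nat \<Rightarrow> nat \<Rightarrow> (nat \<times> nat) letter list set" where
  "pvt_gen n i j \<equiv> word_class (pvt_gens n) (pvt_rels n) [Gen (i, j)]"

definition signed_gen :: "nat \<Rightarrow> nat \<Rightarrow> nat \<Rightarrow> (nat \<times> nat) letter list set" where
  "signed_gen n i j =
     (if i < j then pvt_gen n i j else inv\<^bsub>pvt_presented n\<^esub> pvt_gen n j i)"

lemma pvt_gen_closed: "1 \<le> i \<Longrightarrow> i < j \<Longrightarrow> j \<le> n \<Longrightarrow> pvt_gen n i j \<in> carrier (pvt_presented n)"
  by (rule word_class_closed) (simp add: pvt_gens_def)

lemma signed_gen_closed [simp]:
  "i \<in> {1..n} \<Longrightarrow> j \<in> {1..n} \<Longrightarrow> i \<noteq> j \<Longrightarrow> signed_gen n i j \<in> carrier (pvt_presented n)"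
  by (auto simp: signed_gen_def pvt_gen_closed)

lemma signed_gen_swap:
  "i \<in> {1..n} \<Longrightarrow> j \<in> {1..n} \<Longrightarrow> i \<noteq> j \<Longrightarrow>
    signed_gen n j i = inv\<^bsub>pvt_presented n\<^esub> signed_gen n i j"
  by (auto simp: signed_gen_def pvt_gen_closed)

lemma signed_gen_commute:
  assumes "{i, j, k, l} \<subseteq> {1..n}" "distinct [i, j, k, l]"
  shows "signed_gen n i j \<otimes>\<^bsub>pvt_presented n\<^esub> signed_gen n k l =
    signed_gen n k l \<otimes>\<^bsub>pvt_presented n\<^esub> signed_gen n i j"
proof -
  have pos: "signed_gen n i j \<otimes>\<^bsub>pvt_presented n\<^esub> signed_gen n k l =
      signed_gen n k l \<otimes>\<^bsub>pvt_presented n\<^esub> signed_gen n i j"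
    if "{i, j, k, l} \<subseteq> {1..n}" "distinct [i, j, k, l]" "i < j" "k < l" for i j k l
  proof -
    have gens: "(i, j) \<in> pvt_gens n" "(k, l) \<in> pvt_gens n" using that by (auto simp: pvt_gens_def)
    then have "([Gen (i, j), Gen (k, l)], [Gen (k, l), Gen (i, j)]) \<in> pvt_rels n"
      using that(2) by (auto simp: pvt_rels_def)
    then show ?thesis
      using gens that word_class_relI[of _ _ "pvt_rels n" "pvt_gens n"]
      by (simp add: signed_gen_def mult_word_class)
  qed
  have half: "signed_gen n i j \<otimes>\<^bsub>pvt_presented n\<^esub> signed_gen n k l =
      signed_gen n k l \<otimes>\<^bsub>pvt_presented n\<^esub> signed_gen n i j"
    if "{i, j, k, l} \<subseteq> {1..n}" "distinct [i, j, k, l]" "k < l" for i j k l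
  proof (cases "i < j")
    case False
    then have "signed_gen n j i \<otimes>\<^bsub>pvt_presented n\<^esub> signed_gen n k l =
        signed_gen n k l \<otimes>\<^bsub>pvt_presented n\<^esub> signed_gen n j i"
      using that by (intro pos) auto
    then show ?thesis
      using that by (simp add: signed_gen_swap[of j n i] pvt.commute_inv)
  qed (use that pos in simp)
  show ?thesis
  proof (cases "k < l")
    case False
    then have "signed_gen n i j \<otimes>\<^bsub>pvt_presented n\<^esub> signed_gen n l k =
        signed_gen n l k \<otimes>\<^bsub>pvt_presented n\<^esub> signed_gen n i j"
      using assms by (intro half) auto
    then show ?thesis
      using assms by (simp add: signed_gen_swap[of l n k] pvt.commute_inv)
  qed (use assms half in simp)
qed

text \<open>The action \<open>\<sigma> \<cdot> \<lambda>\<^sub>i\<^sub>,\<^sub>j = \<lambda>\<^sub>\<sigma>\<^sub>i\<^sub>,\<^sub>\<sigma>\<^sub>j\<close>. It respects the defining relations because a permutation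
  keeps four indices distinct, and inverses of commuting elements commute.\<close>

definition perm_act :: "nat \<Rightarrow> (nat \<Rightarrow> nat) \<Rightarrow> (nat \<times> nat) letter list set
    \<Rightarrow> (nat \<times> nat) letter list set" where
  "perm_act n \<sigma> = presented_lift (pvt_presented n) (\<lambda>(i, j). signed_gen n (\<sigma> i) (\<sigma> j))"

context
  fixes n :: nat and \<sigma> assumes \<sigma>: "\<sigma> permutes {1..n}"
begin

lemma permutes_range [unfolded One_nat_def, simp]: "\<sigma> i \<in> {1..n} \<longleftrightarrow> i \<in> {1..n}"
  by (rule permutes_in_image[OF \<sigma>])

lemma permutes_eq_iff [simp]: "\<sigma> i = \<sigma> j \<longleftrightarrow> i = j"
  using permutes_inj[OF \<sigma>] by (auto dest: injD)

lemma permuted_gens_closed: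
  "(\<lambda>(i, j). signed_gen n (\<sigma> i) (\<sigma> j)) \<in> pvt_gens n \<rightarrow> carrier (pvt_presented n)"
proof (safe intro!: funcsetI)
  fix i j assume "(i, j) \<in> pvt_gens n"
  then have "i \<in> {1..n}" "j \<in> {1..n}" "i \<noteq> j" by (auto simp: pvt_gens_def)
  then show "signed_gen n (\<sigma> i) (\<sigma> j) \<in> carrier (pvt_presented n)"
    by (simp del: atLeastAtMost_iff)
qed

lemma permuted_gens_rels:
  assumes "(l, r) \<in> pvt_rels n"
  shows "word_eval (pvt_presented n) (\<lambda>(i, j). signed_gen n (\<sigma> i) (\<sigma> j)) l =
    word_eval (pvt_presented n) (\<lambda>(i, j). signed_gen n (\<sigma> i) (\<sigma> j)) r"
proof -
  obtain i j k m where lr: "l = [Gen (i, j), Gen (k, m)]" "r = [Gen (k, m), Gen (i, j)]"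
    and gens: "(i, j) \<in> pvt_gens n" "(k, m) \<in> pvt_gens n" and dist: "distinct [i, j, k, m]"
    using assms by (auto simp: pvt_rels_def)
  have in_n: "i \<in> {1..n}" "j \<in> {1..n}" "k \<in> {1..n}" "m \<in> {1..n}"
    using gens by (auto simp: pvt_gens_def)
  have "signed_gen n (\<sigma> i) (\<sigma> j) \<otimes>\<^bsub>pvt_presented n\<^esub> signed_gen n (\<sigma> k) (\<sigma> m) =
      signed_gen n (\<sigma> k) (\<sigma> m) \<otimes>\<^bsub>pvt_presented n\<^esub> signed_gen n (\<sigma> i) (\<sigma> j)"
    using in_n dist by (intro signed_gen_commute) (simp_all del: atLeastAtMost_iff)
  moreover have "signed_gen n (\<sigma> i) (\<sigma> j) \<in> carrier (pvt_presented n)"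
    "signed_gen n (\<sigma> k) (\<sigma> m) \<in> carrier (pvt_presented n)"
    using in_n dist by (simp_all del: atLeastAtMost_iff)
  ultimately show ?thesis by (simp add: lr)
qed

lemma perm_act_hom: "perm_act n \<sigma> \<in> hom (pvt_presented n) (pvt_presented n)"
  unfolding perm_act_def
  by (rule pvt.presented_lift_hom[OF permuted_gens_closed permuted_gens_rels])

lemma perm_act_closed [simp]:
  "a \<in> carrier (pvt_presented n) \<Longrightarrow> perm_act n \<sigma> a \<in> carrier (pvt_presented n)"
  using perm_act_hom by (rule hom_in_carrier)

lemma perm_act_one [simp]:
  "perm_act n \<sigma> \<one>\<^bsub>pvt_presented n\<^esub> = \<one>\<^bsub>pvt_presented n\<^esub>"
  by (rule hom_one[OF perm_act_hom group_presented_group group_presented_group])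

lemma perm_act_signed_gen [simp]:
  assumes "i \<in> {1..n}" "j \<in> {1..n}" "i \<noteq> j"
  shows "perm_act n \<sigma> (signed_gen n i j) = signed_gen n (\<sigma> i) (\<sigma> j)"
proof -
  have pos: "perm_act n \<sigma> (pvt_gen n i j) = signed_gen n (\<sigma> i) (\<sigma> j)"
    if "1 \<le> i" "i < j" "j \<le> n" for i j
    unfolding perm_act_def using that
    by (subst pvt.presented_lift_gen[OF permuted_gens_closed permuted_gens_rels])
      (auto simp: pvt_gens_def)
  interpret h: group_hom "pvt_presented n" "pvt_presented n" "perm_act n \<sigma>"
    by unfold_locales (rule perm_act_hom)
  show ?thesis
  proof (cases "i < j")
    case True
    then show ?thesis using pos[of i j] assms by (simp add: signed_gen_def)
  next
    case False
    then have "perm_act n \<sigma> (signed_gen n j i) = signed_gen n (\<sigma> j) (\<sigma> i)"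
      using pos[of j i] assms by (simp add: signed_gen_def)
    then show ?thesis
      using assms signed_gen_swap[of j n i] signed_gen_swap[of "\<sigma> j" n "\<sigma> i"]
      by (simp del: atLeastAtMost_iff)
  qed
qed

end

lemma pvt_hom_eqI:
  assumes "group H" "h \<in> hom (pvt_presented n) H" "h' \<in> hom (pvt_presented n) H"
    and "\<And>i j. i \<in> {1..n} \<Longrightarrow> j \<in> {1..n} \<Longrightarrow> i < j \<Longrightarrow> h (signed_gen n i j) = h' (signed_gen n i j)"
    and "a \<in> carrier (pvt_presented n)"
  shows "h a = h' a"
  using assms(1-3) _ assms(5)
proof (rule presented_hom_eqI)
  fix x assume "x \<in> pvt_gens n"
  then show "h (word_class (pvt_gens n) (pvt_rels n) [Gen x]) =
      h' (word_class (pvt_gens n) (pvt_rels n) [Gen x])"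
    using assms(4)[of "fst x" "snd x"] by (auto simp: pvt_gens_def signed_gen_def)
qed

lemma perm_act_comp:
  assumes \<sigma>: "\<sigma> permutes {1..n}" and \<tau>: "\<tau> permutes {1..n}"
    and "a \<in> carrier (pvt_presented n)"
  shows "perm_act n (\<sigma> \<circ> \<tau>) a = perm_act n \<sigma> (perm_act n \<tau> a)"
proof -
  have \<sigma>\<tau>: "\<sigma> \<circ> \<tau> permutes {1..n}" by (rule permutes_compose[OF \<tau> \<sigma>])
  have "perm_act n (\<sigma> \<circ> \<tau>) a = (perm_act n \<sigma> \<circ> perm_act n \<tau>) a"
  proof (rule pvt_hom_eqI[OF group_presented_group perm_act_hom[OF \<sigma>\<tau>]])
    show "perm_act n \<sigma> \<circ> perm_act n \<tau> \<in> hom (pvt_presented n) (pvt_presented n)"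
      by (rule Group.hom_compose[OF perm_act_hom[OF \<tau>] perm_act_hom[OF \<sigma>]])
  qed (use assms \<sigma>\<tau> in \<open>simp_all del: atLeastAtMost_iff\<close>)
  then show ?thesis by simp
qed

lemma perm_act_id:
  assumes "a \<in> carrier (pvt_presented n)"
  shows "perm_act n id a = a"
proof -
  have "perm_act n id a = id a"
    by (rule pvt_hom_eqI[OF group_presented_group perm_act_hom[OF permutes_id]])
      (use assms in \<open>auto simp: hom_def permutes_id\<close>)
  then show ?thesis by simp
qed


section \<open>A semidirect product receiving the virtual twin group\<close>

definition semidirect :: "('g, 'm) monoid_scheme \<Rightarrow> ('h, 'k) monoid_scheme
    \<Rightarrow> ('h \<Rightarrow> 'g \<Rightarrow> 'g) \<Rightarrow> ('g \<times> 'h) monoid" where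
  "semidirect A H act =
     \<lparr> carrier = carrier A \<times> carrier H,
       mult = (\<lambda>(a, h) (b, k). (a \<otimes>\<^bsub>A\<^esub> act h b, h \<otimes>\<^bsub>H\<^esub> k)),
       one = (\<one>\<^bsub>A\<^esub>, \<one>\<^bsub>H\<^esub>) \<rparr>"

lemma semidirect_simps [simp]:
  "carrier (semidirect A H act) = carrier A \<times> carrier H"
  "(a, h) \<otimes>\<^bsub>semidirect A H act\<^esub> (b, k) = (a \<otimes>\<^bsub>A\<^esub> act h b, h \<otimes>\<^bsub>H\<^esub> k)"
  "\<one>\<^bsub>semidirect A H act\<^esub> = (\<one>\<^bsub>A\<^esub>, \<one>\<^bsub>H\<^esub>)"
  by (simp_all add: semidirect_def)

lemma group_semidirect:
  assumes "group A" "group H"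
    and hom: "\<And>h. h \<in> carrier H \<Longrightarrow> act h \<in> hom A A"
    and comp: "\<And>h k a. h \<in> carrier H \<Longrightarrow> k \<in> carrier H \<Longrightarrow> a \<in> carrier A \<Longrightarrow>
      act (h \<otimes>\<^bsub>H\<^esub> k) a = act h (act k a)"
    and act_one: "\<And>a. a \<in> carrier A \<Longrightarrow> act \<one>\<^bsub>H\<^esub> a = a"
  shows "group (semidirect A H act)"
proof -
  interpret A: group A by fact
  interpret H: group H by fact
  have closed [simp]: "act h a \<in> carrier A" if "h \<in> carrier H" "a \<in> carrier A" for h a
    using hom_in_carrier[OF hom] that by blast
  have mult [simp]: "act h (a \<otimes>\<^bsub>A\<^esub> b) = act h a \<otimes>\<^bsub>A\<^esub> act h b"
    if "h \<in> carrier H" "a \<in> carrier A" "b \<in> carrier A" for h a b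
    using hom_mult[OF hom] that by blast
  have one [simp]: "act h \<one>\<^bsub>A\<^esub> = \<one>\<^bsub>A\<^esub>" if "h \<in> carrier H" for h
    using hom_one[OF hom] that assms(1) by blast
  show ?thesis
  proof (rule groupI)
    fix x assume "x \<in> carrier (semidirect A H act)"
    then obtain a h where x: "x = (a, h)" and c: "a \<in> carrier A" "h \<in> carrier H" by auto
    have "act (inv\<^bsub>H\<^esub> h) (inv\<^bsub>A\<^esub> a) \<otimes>\<^bsub>A\<^esub> act (inv\<^bsub>H\<^esub> h) a = \<one>\<^bsub>A\<^esub>"
      using c by (simp flip: mult)
    then show "\<exists>y\<in>carrier (semidirect A H act).
        y \<otimes>\<^bsub>semidirect A H act\<^esub> x = \<one>\<^bsub>semidirect A H act\<^esub>"
      using c by (intro bexI[of _ "(act (inv\<^bsub>H\<^esub> h) (inv\<^bsub>A\<^esub> a), inv\<^bsub>H\<^esub> h)"]) (simp_all add: x)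
  qed (auto simp: comp act_one A.m_assoc H.m_assoc)
qed

abbreviation pvt_semidirect ::
    "nat \<Rightarrow> ((nat \<times> nat) letter list set \<times> (nat \<Rightarrow> nat)) monoid" where
  "pvt_semidirect n \<equiv> semidirect (pvt_presented n) (sym_group n) (perm_act n)"

interpretation pvt_semidirect: group "pvt_semidirect n" for n
  by (rule group_semidirect)
    (simp_all add: group_presented_group sym_group_is_group sym_group_carrier sym_group_mult
      sym_group_one perm_act_hom perm_act_comp perm_act_id)

text \<open>The values that \<open>s\<^sub>i\<close> and \<open>\<rho>\<^sub>i\<close> must have if \<open>\<rho>\<^sub>i\<close> is to be the permutation \<open>(i i+1)\<close> itself and
  \<open>s\<^sub>i \<rho>\<^sub>i\<close> the generator \<open>\<lambda>\<^sub>i\<^sub>,\<^sub>i\<^sub>+\<^sub>1\<close>.\<close>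

primrec vt_split :: "nat \<Rightarrow> vt_gen \<Rightarrow> (nat \<times> nat) letter list set \<times> (nat \<Rightarrow> nat)" where
  "vt_split n (Tw i) = (signed_gen n i (Suc i), transpose i (Suc i))"
| "vt_split n (Vr i) = (\<one>\<^bsub>pvt_presented n\<^esub>, transpose i (Suc i))"

lemma transpose_Suc_permutes: "1 \<le> i \<Longrightarrow> i < n \<Longrightarrow> transpose i (Suc i) permutes {1..n}"
  by (intro permutes_swap_id) auto

lemma vt_split_closed: "vt_split n \<in> vt_gens n \<rightarrow> carrier (pvt_semidirect n)"
  using transpose_Suc_permutes
  by (auto simp: vt_gens_def sym_group_carrier)

lemma signed_gen_mult_swap:
  "i \<in> {1..n} \<Longrightarrow> j \<in> {1..n} \<Longrightarrow> i \<noteq> j \<Longrightarrow>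
    signed_gen n i j \<otimes>\<^bsub>pvt_presented n\<^esub> signed_gen n j i = \<one>\<^bsub>pvt_presented n\<^esub>"
  by (subst signed_gen_swap[of i n j]) simp_all

text \<open>Besides the relations of the symmetric group this uses that a transposition fixes each
  \<open>\<lambda>\<^sub>i\<^sub>,\<^sub>j\<close> with disjoint indices, and three further facts. The relation \<open>s\<^sub>i\<^sup>2 = 1\<close> holds because \<open>(i i+1)\<close> inverts \<open>\<lambda>\<^sub>i\<^sub>,\<^sub>i\<^sub>+\<^sub>1\<close>, the commutation of \<open>s\<^sub>i\<close> and \<open>s\<^sub>j\<close>
  is a defining relation between generators with disjoint indices, and the mixed relation says
  that \<open>(i i+1) (i+1 i+2)\<close> takes \<open>\<lambda>\<^sub>i\<^sub>,\<^sub>i\<^sub>+\<^sub>1\<close> to \<open>\<lambda>\<^sub>i\<^sub>+\<^sub>1\<^sub>,\<^sub>i\<^sub>+\<^sub>2\<close>.\<close>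

lemma vt_split_rels:
  assumes "(l, r) \<in> vt_rels n"
  shows "word_eval (pvt_semidirect n) (vt_split n) l = word_eval (pvt_semidirect n) (vt_split n) r"
  using assms unfolding vt_rels_def
proof (elim UnE CollectE exE conjE Pair_inject)
  note [simp] = sym_group_mult sym_group_one transpose_Suc_permutes[simplified] transpose_apply_other
    transpose_Suc_commute signed_gen_mult_swap
  {
    fix i assume lr: "l = s_word i @ s_word i" "r = []" and "i \<in> {1..n - 1}"
    then have "1 \<le> i" "i < n" by auto
    then show ?thesis by (simp add: lr)
  next
    fix i assume lr: "l = \<rho>_word i @ \<rho>_word i" "r = []" and "i \<in> {1..n - 1}"
    then have "1 \<le> i" "i < n" by auto
    then show ?thesis by (simp add: lr)
  next
    fix i j assume lr: "l = s_word i @ s_word j" "r = s_word j @ s_word i"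
      and "i \<in> {1..n - 1}" "j \<in> {1..n - 1}" and far: "2 \<le> \<bar>int i - int j\<bar>"
    then have ij: "1 \<le> i" "i < n" "1 \<le> j" "j < n" "i \<noteq> j" "Suc i \<noteq> j" "i \<noteq> Suc j" by auto
    then have "signed_gen n i (Suc i) \<otimes>\<^bsub>pvt_presented n\<^esub> signed_gen n j (Suc j) =
        signed_gen n j (Suc j) \<otimes>\<^bsub>pvt_presented n\<^esub> signed_gen n i (Suc i)"
      by (intro signed_gen_commute) auto
    then show ?thesis using ij far by (simp add: lr)
  next
    fix i j assume lr: "l = \<rho>_word i @ \<rho>_word j" "r = \<rho>_word j @ \<rho>_word i"
      and "i \<in> {1..n - 1}" "j \<in> {1..n - 1}" and far: "2 \<le> \<bar>int i - int j\<bar>"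
    then have ij: "1 \<le> i" "i < n" "1 \<le> j" "j < n" by auto
    then show ?thesis using far by (simp add: lr)
  next
    fix i j assume lr: "l = \<rho>_word i @ s_word j" "r = s_word j @ \<rho>_word i"
      and "i \<in> {1..n - 1}" "j \<in> {1..n - 1}" and far: "2 \<le> \<bar>int i - int j\<bar>"
    then have ij: "1 \<le> i" "i < n" "1 \<le> j" "j < n" "i \<noteq> j" "Suc i \<noteq> j" "i \<noteq> Suc j" by auto
    then show ?thesis using far by (simp add: lr)
  next
    fix i assume lr: "l = \<rho>_word i @ \<rho>_word (i + 1) @ \<rho>_word i"
        "r = \<rho>_word (i + 1) @ \<rho>_word i @ \<rho>_word (i + 1)"
      and "i \<in> {1..n - 2}"
    then have "1 \<le> i" "Suc i < n" by auto
    then show ?thesis by (simp add: lr transpose_Suc_braid)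
  next
    fix i assume lr: "l = \<rho>_word i @ \<rho>_word (i + 1) @ s_word i"
        "r = s_word (i + 1) @ \<rho>_word i @ \<rho>_word (i + 1)"
      and "i \<in> {1..n - 2}"
    then have "1 \<le> i" "Suc i < n" by auto
    then show ?thesis by (simp add: lr transpose_Suc_braid)
  }
qed

definition vt_splitting :: "nat \<Rightarrow> vt_gen letter list set
    \<Rightarrow> (nat \<times> nat) letter list set \<times> (nat \<Rightarrow> nat)" where
  "vt_splitting n = presented_lift (pvt_semidirect n) (vt_split n)"

lemma vt_splitting_hom: "vt_splitting n \<in> hom (VT n) (pvt_semidirect n)"
  unfolding vt_splitting_def VT_def
  by (rule pvt_semidirect.presented_lift_hom[OF vt_split_closed vt_split_rels])

lemma vt_splitting_gen:
  "x \<in> vt_gens n \<Longrightarrow> vt_splitting n (word_class (vt_gens n) (vt_rels n) [Gen x]) = vt_split n x"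
  unfolding vt_splitting_def
  by (rule pvt_semidirect.presented_lift_gen[OF vt_split_closed vt_split_rels])


section \<open>The isomorphism onto the pure virtual twin group\<close>

abbreviation vt_class :: "nat \<Rightarrow> vt_gen letter list \<Rightarrow> vt_gen letter list set" where
  "vt_class n \<equiv> word_class (vt_gens n) (vt_rels n)"

lemma vt_gens_simps [simp]:
  "Tw i \<in> vt_gens n \<longleftrightarrow> 1 \<le> i \<and> i < n" "Vr i \<in> vt_gens n \<longleftrightarrow> 1 \<le> i \<and> i < n"
  by (auto simp: vt_gens_def)

lemma mult_vt_class:
  "u \<in> words (vt_gens n) \<Longrightarrow> v \<in> words (vt_gens n) \<Longrightarrow>
    vt_class n u \<otimes>\<^bsub>VT n\<^esub> vt_class n v = vt_class n (u @ v)"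
  unfolding VT_def by (rule mult_word_class)

lemma one_VT: "\<one>\<^bsub>VT n\<^esub> = vt_class n []"
  unfolding VT_def by (rule one_presented_group)

lemma vt_class_closed: "w \<in> words (vt_gens n) \<Longrightarrow> vt_class n w \<in> carrier (VT n)"
  unfolding VT_def by (rule word_class_closed)

lemma vt_class_relI:
  "(l, r) \<in> vt_rels n \<Longrightarrow> l \<in> words (vt_gens n) \<Longrightarrow> r \<in> words (vt_gens n) \<Longrightarrow>
    vt_class n l = vt_class n r"
  by (rule word_class_relI)

lemma vt_rels_intros:
  "1 \<le> i \<Longrightarrow> i < n \<Longrightarrow> (s_word i @ s_word i, []) \<in> vt_rels n"
  "1 \<le> i \<Longrightarrow> i < n \<Longrightarrow> (\<rho>_word i @ \<rho>_word i, []) \<in> vt_rels n"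
  "1 \<le> i \<Longrightarrow> i + 2 \<le> j \<Longrightarrow> j < n \<Longrightarrow> (s_word i @ s_word j, s_word j @ s_word i) \<in> vt_rels n"
  "1 \<le> i \<Longrightarrow> i + 2 \<le> j \<Longrightarrow> j < n \<Longrightarrow> (\<rho>_word i @ \<rho>_word j, \<rho>_word j @ \<rho>_word i) \<in> vt_rels n"
  "1 \<le> i \<Longrightarrow> i < n \<Longrightarrow> 1 \<le> j \<Longrightarrow> j < n \<Longrightarrow> i + 2 \<le> j \<or> j + 2 \<le> i \<Longrightarrow>
    (\<rho>_word i @ s_word j, s_word j @ \<rho>_word i) \<in> vt_rels n"
  "1 \<le> i \<Longrightarrow> Suc i < n \<Longrightarrow>
    (\<rho>_word i @ \<rho>_word (Suc i) @ \<rho>_word i, \<rho>_word (Suc i) @ \<rho>_word i @ \<rho>_word (Suc i)) \<in> vt_rels n"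
  "1 \<le> i \<Longrightarrow> Suc i < n \<Longrightarrow>
    (\<rho>_word i @ \<rho>_word (Suc i) @ s_word i, s_word (Suc i) @ \<rho>_word i @ \<rho>_word (Suc i)) \<in> vt_rels n"
  by (auto simp: vt_rels_def)

interpretation VT: virtual_twin_relations
  "VT n" n "\<lambda>i. vt_class n (\<rho>_word i)" "\<lambda>i. vt_class n (s_word i)" for n
proof (intro virtual_twin_relations.intro coxeter_relations.intro
    coxeter_relations_axioms.intro virtual_twin_relations_axioms.intro)
  show "group (VT n)" unfolding VT_def by (rule group_presented_group)
next
  fix i :: nat assume i: "1 \<le> i" "i < n"
  then show "vt_class n (\<rho>_word i) \<in> carrier (VT n)" "vt_class n (s_word i) \<in> carrier (VT n)"
    by (simp_all add: vt_class_closed)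
  show "vt_class n (\<rho>_word i) \<otimes>\<^bsub>VT n\<^esub> vt_class n (\<rho>_word i) = \<one>\<^bsub>VT n\<^esub>"
    "vt_class n (s_word i) \<otimes>\<^bsub>VT n\<^esub> vt_class n (s_word i) = \<one>\<^bsub>VT n\<^esub>"
    using i vt_class_relI[OF vt_rels_intros(1)] vt_class_relI[OF vt_rels_intros(2)]
    by (simp_all add: mult_vt_class one_VT)
next
  fix i j :: nat assume "1 \<le> i" "i + 2 \<le> j" "j < n"
  then show "vt_class n (\<rho>_word i) \<otimes>\<^bsub>VT n\<^esub> vt_class n (\<rho>_word j) =
      vt_class n (\<rho>_word j) \<otimes>\<^bsub>VT n\<^esub> vt_class n (\<rho>_word i)"
    "vt_class n (s_word i) \<otimes>\<^bsub>VT n\<^esub> vt_class n (s_word j) =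
      vt_class n (s_word j) \<otimes>\<^bsub>VT n\<^esub> vt_class n (s_word i)"
    using vt_class_relI[OF vt_rels_intros(3)] vt_class_relI[OF vt_rels_intros(4)]
    by (simp_all add: mult_vt_class)
next
  fix i j :: nat assume "1 \<le> i" "i < n" "1 \<le> j" "j < n" "i + 2 \<le> j \<or> j + 2 \<le> i"
  then show "vt_class n (\<rho>_word i) \<otimes>\<^bsub>VT n\<^esub> vt_class n (s_word j) =
      vt_class n (s_word j) \<otimes>\<^bsub>VT n\<^esub> vt_class n (\<rho>_word i)"
    using vt_class_relI[OF vt_rels_intros(5)]
    by (simp add: mult_vt_class)
next
  fix i :: nat assume "1 \<le> i" "Suc i < n"
  then show "vt_class n (\<rho>_word i) \<otimes>\<^bsub>VT n\<^esub>
        (vt_class n (\<rho>_word (Suc i)) \<otimes>\<^bsub>VT n\<^esub> vt_class n (\<rho>_word i)) =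
      vt_class n (\<rho>_word (Suc i)) \<otimes>\<^bsub>VT n\<^esub>
        (vt_class n (\<rho>_word i) \<otimes>\<^bsub>VT n\<^esub> vt_class n (\<rho>_word (Suc i)))"
    "vt_class n (\<rho>_word i) \<otimes>\<^bsub>VT n\<^esub>
        (vt_class n (\<rho>_word (Suc i)) \<otimes>\<^bsub>VT n\<^esub> vt_class n (s_word i)) =
      vt_class n (s_word (Suc i)) \<otimes>\<^bsub>VT n\<^esub>
        (vt_class n (\<rho>_word i) \<otimes>\<^bsub>VT n\<^esub> vt_class n (\<rho>_word (Suc i)))"
    using vt_class_relI[OF vt_rels_intros(6)] vt_class_relI[OF vt_rels_intros(7)]
    by (simp_all add: mult_vt_class)
qed

lemma lam_elem_eq:
  assumes "1 \<le> i" "i < j" "j \<le> n"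
  shows "lam_elem n i j = VT.lam n i j"
  using assms(2,3)
proof (induction j)
  case 0
  then show ?case by simp
next
  case (Suc j)
  show ?case
  proof (cases "j = i")
    case True
    then show ?thesis using assms(1) Suc.prems by (simp add: lam_elem_def mult_vt_class)
  next
    case False
    define w where "w = concat (map \<rho>_word (rev [i + 1..<j])) @ (s_word i @ \<rho>_word i) @
      concat (map \<rho>_word [i + 1..<j])"
    have rho: "concat (map \<rho>_word ks) \<in> words (vt_gens n)" if "set ks \<subseteq> {1..<n}" for ks
      using that by (induction ks) auto
    have w: "w \<in> words (vt_gens n)"
      unfolding w_def words_simps using assms(1) Suc.prems False
      by (intro conjI rho) auto
    have lam: "lam_elem n i j = vt_class n w" by (simp only: lam_elem_def w_def)
    have "lam_elem n i (Suc j) = vt_class n (\<rho>_word j @ w @ \<rho>_word j)"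
      using False Suc.prems by (simp add: lam_elem_def w_def)
    also have "\<dots> = VT.conj_r n j (lam_elem n i j)"
      using w False assms(1) Suc.prems
      by (simp add: VT.conj_r_def lam mult_vt_class)
    finally show ?thesis using Suc False by simp
  qed
qed

interpretation sym_group: group "sym_group n" for n by (rule sym_group_is_group)

interpretation vt_perm: group_hom "VT n" "sym_group n" "vt_perm n" for n
  by unfold_locales (rule vt_perm_hom)

lemma carrier_PVT: "carrier (PVT n) = {x \<in> carrier (VT n). vt_perm n x = id}"
  by (simp add: PVT_def kernel_def sym_group_one)

lemma mult_PVT: "x \<otimes>\<^bsub>PVT n\<^esub> y = x \<otimes>\<^bsub>VT n\<^esub> y"
  by (simp add: PVT_def)

lemma vt_perm_lam:
  assumes "1 \<le> i" "i < j" "j \<le> n"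
  shows "vt_perm n (VT.lam n i j) = id"
  using assms(2,3)
proof (induction j)
  case (Suc j)
  show ?case
    using assms(1) Suc vt_perm_gen[of _ n]
    by (auto simp: VT.conj_r_def sym_group_mult)
qed simp

interpretation PVT: group "PVT n" for n by (rule group_PVT)

lemma lam_elem_closed: "(\<lambda>(i, j). lam_elem n i j) \<in> pvt_gens n \<rightarrow> carrier (PVT n)"
  by (auto simp: pvt_gens_def lam_elem_eq carrier_PVT vt_perm_lam)

lemma lam_elem_rels:
  assumes "(l, r) \<in> pvt_rels n"
  shows "word_eval (PVT n) (\<lambda>(i, j). lam_elem n i j) l =
    word_eval (PVT n) (\<lambda>(i, j). lam_elem n i j) r"
proof -
  obtain i j k m where lr: "l = [Gen (i, j), Gen (k, m)]" "r = [Gen (k, m), Gen (i, j)]"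
    and gens: "(i, j) \<in> pvt_gens n" "(k, m) \<in> pvt_gens n" and dist: "distinct [i, j, k, m]"
    using assms by (auto simp: pvt_rels_def)
  have "VT.signed_lam_commute n i j k m"
    using gens dist by (intro VT.signed_lam_commute_distinct) (auto simp: pvt_gens_def)
  then have "lam_elem n i j \<otimes>\<^bsub>PVT n\<^esub> lam_elem n k m =
      lam_elem n k m \<otimes>\<^bsub>PVT n\<^esub> lam_elem n i j"
    using gens by (simp add: mult_PVT VT.signed_lam_commute_def VT.signed_lam_def pvt_gens_def lam_elem_eq)
  moreover have "lam_elem n i j \<in> carrier (PVT n)" "lam_elem n k m \<in> carrier (PVT n)"
    using funcset_mem[OF lam_elem_closed gens(1)] funcset_mem[OF lam_elem_closed gens(2)]
    by simp_all
  ultimately show ?thesis by (simp add: lr)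
qed

definition pvt_iso :: "nat \<Rightarrow> (nat \<times> nat) letter list set \<Rightarrow> vt_gen letter list set" where
  "pvt_iso n = presented_lift (PVT n) (\<lambda>(i, j). lam_elem n i j)"

lemma pvt_iso_hom_PVT: "pvt_iso n \<in> hom (pvt_presented n) (PVT n)"
  unfolding pvt_iso_def by (rule PVT.presented_lift_hom[OF lam_elem_closed lam_elem_rels])

lemma pvt_iso_gen: "(i, j) \<in> pvt_gens n \<Longrightarrow> pvt_iso n (pvt_gen n i j) = lam_elem n i j"
  unfolding pvt_iso_def
  by (subst PVT.presented_lift_gen[OF lam_elem_closed lam_elem_rels]) simp_all

lemma pvt_iso_hom: "pvt_iso n \<in> hom (pvt_presented n) (VT n)"
  using pvt_iso_hom_PVT by (auto simp: hom_def carrier_PVT mult_PVT Pi_iff)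

interpretation pvt_iso: group_hom "pvt_presented n" "VT n" "pvt_iso n" for n
  by unfold_locales (rule pvt_iso_hom)

lemma pvt_iso_signed_gen:
  assumes "i \<in> {1..n}" "j \<in> {1..n}" "i \<noteq> j"
  shows "pvt_iso n (signed_gen n i j) = VT.signed_lam n i j"
proof -
  have "pvt_iso n (pvt_gen n i j) = VT.lam n i j" if "1 \<le> i" "i < j" "j \<le> n" for i j
    using that by (subst pvt_iso_gen) (simp_all add: pvt_gens_def lam_elem_eq)
  then show ?thesis
    using assms by (auto simp: signed_gen_def VT.signed_lam_def pvt_gen_closed)
qed

lemma vt_splitting_lam:
  assumes "1 \<le> i" "i < j" "j \<le> n"
  shows "vt_splitting n (VT.lam n i j) = (signed_gen n i j, id)"
  using assms(2,3)
proof (induction j)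
  case 0
  then show ?case by simp
next
  case (Suc j)
  interpret h: group_hom "VT n" "pvt_semidirect n" "vt_splitting n"
    by unfold_locales (rule vt_splitting_hom)
  note [simp] = vt_splitting_gen sym_group_mult transpose_Suc_permutes[simplified]
  show ?case
  proof (cases "j = i")
    case True
    then show ?thesis using assms(1) Suc.prems by (simp add: fun_eq_iff del: semidirect_simps(1,3))
  next
    case False
    then show ?thesis
      using assms(1) Suc
      by (simp add: VT.conj_r_def transpose_apply_other perm_act_id[unfolded id_def] fun_eq_iff
          del: semidirect_simps(1,3))
  qed
qed

text \<open>Both sides are homomorphisms, so it suffices to compare them on generators. This is what makes
  \<open>pvt_iso\<close> injective.\<close>

lemma vt_splitting_pvt_iso:
  assumes "a \<in> carrier (pvt_presented n)"
  shows "vt_splitting n (pvt_iso n a) = (a, id)"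
proof -
  have "(vt_splitting n \<circ> pvt_iso n) a = (\<lambda>a. (a, id)) a"
  proof (rule pvt_hom_eqI[OF pvt_semidirect.is_group _ _ _ assms])
    show "vt_splitting n \<circ> pvt_iso n \<in> hom (pvt_presented n) (pvt_semidirect n)"
      by (rule Group.hom_compose[OF pvt_iso_hom vt_splitting_hom])
    show "(\<lambda>a. (a, id)) \<in> hom (pvt_presented n) (pvt_semidirect n)"
      by (auto simp: hom_def sym_group_carrier sym_group_mult permutes_id perm_act_id)
  next
    fix i j assume "i \<in> {1..n}" "j \<in> {1..n}" "i < j"
    then show "(vt_splitting n \<circ> pvt_iso n) (signed_gen n i j) = (signed_gen n i j, id)"
      by (simp add: pvt_iso_signed_gen VT.signed_lam_def vt_splitting_lam)
  qed
  then show ?thesis by simp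
qed

text \<open>The image of \<open>pvt_iso\<close> is normalised by each \<open>\<rho>\<^sub>k\<close> because on generators this is the action on
  indices.\<close>

lemma conj_r_pvt_iso:
  assumes k: "1 \<le> k" "k < n" and a: "a \<in> carrier (pvt_presented n)"
  shows "VT.conj_r n k (pvt_iso n a) = pvt_iso n (perm_act n (transpose k (Suc k)) a)"
proof -
  let ?t = "transpose k (Suc k)"
  have t: "?t permutes {1..n}" using k by (rule transpose_Suc_permutes)
  have "(VT.conj_r n k \<circ> pvt_iso n) a = (pvt_iso n \<circ> perm_act n ?t) a"
  proof (rule pvt_hom_eqI[OF VT.is_group _ _ _ a])
    have "VT.conj_r n k \<in> hom (VT n) (VT n)"
      using k by (simp add: hom_def VT.conj_r_mult)
    then show "VT.conj_r n k \<circ> pvt_iso n \<in> hom (pvt_presented n) (VT n)"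
      by (rule Group.hom_compose[OF pvt_iso_hom])
    show "pvt_iso n \<circ> perm_act n ?t \<in> hom (pvt_presented n) (VT n)"
      by (rule Group.hom_compose[OF perm_act_hom[OF t] pvt_iso_hom])
  next
    fix i j assume ij: "i \<in> {1..n}" "j \<in> {1..n}" "i < j"
    then have "?t i \<in> {1..n}" "?t j \<in> {1..n}" "?t i \<noteq> ?t j"
      using VT.transpose_Suc_in k by (auto simp: transpose_eq_iff simp del: atLeastAtMost_iff)
    then have "pvt_iso n (signed_gen n (?t i) (?t j)) = VT.signed_lam n (?t i) (?t j)"
      by (rule pvt_iso_signed_gen)
    then show "(VT.conj_r n k \<circ> pvt_iso n) (signed_gen n i j) =
        (pvt_iso n \<circ> perm_act n ?t) (signed_gen n i j)"
      using ij k perm_act_signed_gen[OF t ij(1,2)] VT.conj_r_slam[OF ij(1,2) _ k]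
      by (simp add: pvt_iso_signed_gen)
  qed
  then show ?thesis by simp
qed

text \<open>The set of such products contains \<open>1\<close> and is closed under left multiplication by \<open>\<rho>\<^sub>i\<close>, which
  passes through \<open>pvt_iso n a\<close> at the cost of acting on \<open>a\<close>, and hence by
  \<open>s\<^sub>i = \<lambda>\<^sub>i\<^sub>,\<^sub>i\<^sub>+\<^sub>1 \<rho>\<^sub>i\<close>. The generators are involutions, so inverse letters add nothing.\<close>

lemma VT_factorization:
  assumes "g \<in> carrier (VT n)"
  shows "\<exists>a \<in> carrier (pvt_presented n).
    \<exists>h \<in> generate (VT n) ((\<lambda>i. vt_class n (\<rho>_word i)) ` {1..n - 1}).
      g = pvt_iso n a \<otimes>\<^bsub>VT n\<^esub> h"
    (is "?P g")
proof -
  let ?H = "generate (VT n) ((\<lambda>i. vt_class n (\<rho>_word i)) ` {1..n - 1})"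
  have H_closed: "h \<in> carrier (VT n)" if "h \<in> ?H" for h
    using that by (rule VT.generate_in_carrier[rotated]) auto
  have rho: "?P (vt_class n (\<rho>_word i) \<otimes>\<^bsub>VT n\<^esub> g)" if i: "1 \<le> i" "i < n" and "?P g" for i g
  proof -
    obtain a h where a: "a \<in> carrier (pvt_presented n)" and h: "h \<in> ?H"
      and g: "g = pvt_iso n a \<otimes>\<^bsub>VT n\<^esub> h" using \<open>?P g\<close> by blast
    let ?b = "perm_act n (transpose i (Suc i)) a"
    have b: "?b \<in> carrier (pvt_presented n)"
      using a i by (intro perm_act_closed transpose_Suc_permutes)
    have "vt_class n (\<rho>_word i) \<otimes>\<^bsub>VT n\<^esub> g =
        VT.conj_r n i (pvt_iso n a) \<otimes>\<^bsub>VT n\<^esub> (vt_class n (\<rho>_word i) \<otimes>\<^bsub>VT n\<^esub> h)"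
      using a i H_closed[OF h] by (simp add: g VT.conj_r_def VT.m_assoc)
    moreover have "vt_class n (\<rho>_word i) \<otimes>\<^bsub>VT n\<^esub> h \<in> ?H"
      using i by (intro generate.eng[OF generate.incl h]) auto
    ultimately show ?thesis using b conj_r_pvt_iso[OF i a] by auto
  qed
  have tw: "?P (vt_class n (s_word i) \<otimes>\<^bsub>VT n\<^esub> g)"
    if i: "1 \<le> i" "i < n" and g: "g \<in> carrier (VT n)" and "?P g" for i g
  proof -
    obtain a h where a: "a \<in> carrier (pvt_presented n)" and h: "h \<in> ?H"
      and eq: "vt_class n (\<rho>_word i) \<otimes>\<^bsub>VT n\<^esub> g = pvt_iso n a \<otimes>\<^bsub>VT n\<^esub> h"
      using rho[OF i \<open>?P g\<close>] by blast
    let ?l = "signed_gen n i (Suc i)"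
    have l: "?l \<in> carrier (pvt_presented n)" using i by simp
    have "pvt_iso n ?l = vt_class n (s_word i) \<otimes>\<^bsub>VT n\<^esub> vt_class n (\<rho>_word i)"
      using i by (simp add: pvt_iso_signed_gen VT.signed_lam_def)
    then have "vt_class n (s_word i) \<otimes>\<^bsub>VT n\<^esub> g =
        pvt_iso n ?l \<otimes>\<^bsub>VT n\<^esub> (vt_class n (\<rho>_word i) \<otimes>\<^bsub>VT n\<^esub> g)"
      using i g by (simp add: VT.m_assoc)
    also have "\<dots> = pvt_iso n (?l \<otimes>\<^bsub>pvt_presented n\<^esub> a) \<otimes>\<^bsub>VT n\<^esub> h"
      using a l H_closed[OF h] by (simp add: eq VT.m_assoc)
    finally show ?thesis using a l h by blast
  qed
  have step: "?P (vt_class n [Gen x] \<otimes>\<^bsub>VT n\<^esub> g)"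
    if "x \<in> vt_gens n" "g \<in> carrier (VT n)" "?P g" for x g
    using that by (cases x) (simp_all only: rho tw vt_gens_simps)
  have inv_gen: "inv\<^bsub>VT n\<^esub> vt_class n [Gen x] = vt_class n [Gen x]" if "x \<in> vt_gens n" for x
    using that by (cases x) auto
  have "?P \<one>\<^bsub>VT n\<^esub>"
    by (intro bexI[of _ "\<one>\<^bsub>pvt_presented n\<^esub>"] bexI[of _ "\<one>\<^bsub>VT n\<^esub>"]) (simp_all add: generate.one)
  have "g \<in> carrier (presented_group (vt_gens n) (vt_rels n))" using assms by (simp add: VT_def)
  then show ?thesis
  proof (induction rule: presented_group_induct)
    case one
    then show ?case using \<open>?P \<one>\<^bsub>VT n\<^esub>\<close> by (simp only: VT_def)
  next
    case (gen x g)
    then show ?case using step[of x g] by (simp only: VT_def)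
  next
    case (inv x g)
    then show ?case using step[of x g] inv_gen[of x] by (simp only: VT_def)
  qed
qed

theorem theorem3p3:
  fixes n :: nat
  assumes "n \<ge> 2"
  shows "has_presentation (PVT n) (pvt_gens n) (pvt_rels n) (\<lambda>(i, j). lam_elem n i j)"
proof -
  have "inj_on (pvt_iso n) (carrier (pvt_presented n))"
    by (rule inj_on_inverseI[of _ "fst \<circ> vt_splitting n"]) (simp add: vt_splitting_pvt_iso)
  moreover have "pvt_iso n ` carrier (pvt_presented n) = carrier (PVT n)"
  proof (intro equalityI subsetI)
    fix g assume "g \<in> pvt_iso n ` carrier (pvt_presented n)"
    then show "g \<in> carrier (PVT n)" using hom_in_carrier[OF pvt_iso_hom_PVT] by blast
  next
    fix g assume "g \<in> carrier (PVT n)"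
    then have g: "g \<in> carrier (VT n)" "vt_perm n g = id" by (auto simp: carrier_PVT)
    obtain a h where a: "a \<in> carrier (pvt_presented n)"
      and h: "h \<in> generate (VT n) ((\<lambda>i. vt_class n (\<rho>_word i)) ` {1..n - 1})"
      and eq: "g = pvt_iso n a \<otimes>\<^bsub>VT n\<^esub> h"
      using VT_factorization[OF g(1)] by blast
    have h_closed: "h \<in> carrier (VT n)" using VT.r_generate_closed[OF _ h] assms by simp
    have "vt_perm n (pvt_iso n a) = id"
      using hom_in_carrier[OF pvt_iso_hom_PVT a] by (simp add: carrier_PVT)
    then have "vt_perm n h = id" using g(2) a h_closed by (simp add: eq sym_group_mult)
    then have "h = \<one>\<^bsub>VT n\<^esub>"
      using assms h vt_perm_gen(2)[of _ n]
      by (intro VT.\<pi>_injective[OF vt_perm.group_hom_axioms, of n "n - 1"]) auto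
    then show "g \<in> pvt_iso n ` carrier (pvt_presented n)" using a by (simp add: eq)
  qed
  ultimately have "pvt_iso n \<in> iso (pvt_presented n) (PVT n)"
    using pvt_iso_hom_PVT by (simp add: iso_def bij_betw_def)
  moreover have "\<forall>x\<in>pvt_gens n.
      pvt_iso n (word_class (pvt_gens n) (pvt_rels n) [Gen x]) = (\<lambda>(i, j). lam_elem n i j) x"
    by (auto simp: pvt_iso_gen)
  ultimately show ?thesis
    unfolding has_presentation_def using group_PVT lam_elem_closed by blast
qed

end
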